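(* Let $K$ be an algebraically closed field and let $S = K[x,y,z]$ be the polynomial ring graded by $\deg x = \deg y = \deg z = 1$. Let $f$ and $g$ be homogeneous polynomials in $S$ such that $S/(f,g)$ is a $1$-dimensional reduced ring. Put $\deg f = m$ and $\deg g = n$. Let $A$ and $B$ be two distinct points in $\mathbb{P}^2 = \mathbb{P}^2_K$, and assume that $$f \in I_A^{\,m},\quad g \in I_B^{\,n},\quad f \notin I_B \quad\text{and}\quad g \notin I_A.$$ Set $$H = \{A, B\} \cup \{P \in \mathbb{P}^2 \mid (f,g) \subseteq I_P\}.$$ Then the symbolic Rees ring $\mathscr{R}_s(I_H)$ is finitely generated.
   Context: For a point $P = (a:b:c) \in \mathbb{P}^2$, $I_P$ denotes the ideal of $S$ generated by the maximal minors of the matrix $\begin{pmatrix} x & y & z \\ a & b & c \end{pmatrix}$, i.e. the homogeneous prime ideal defining $P$. For a finite set $H = \{P_1,\dots,P_e\}$ of $e$ points of $\mathbb{P}^2$, $I_H = I_{P_1} \cap \cdots \cap I_{P_e}$. For a proper ideal $\mathfrak{a}$ of a commutative Noetherian ring $R$ and $r \in \mathbb{Z}$, the $r$-th symbolic power is $\mathfrak{a}^{(r)} = \bigcap_{\mathfrak{p} \in \mathrm{Min}\,\mathfrak{a}} (\mathfrak{p}^r R_{\mathfrak{p}} \cap R)$, where $\mathrm{Min}\,\mathfrak{a}$ is the set of minimal prime divisors of $\mathfrak{a}$ (non-positive powers of an ideal being the unit ideal). In particular $I_H^{(r)} = I_{P_1}^{\,r} \cap \cdots \cap I_{P_e}^{\,r}$.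 The symbolic Rees ring of $\mathfrak{a}$ is the subring $\mathscr{R}_s(\mathfrak{a}) = \sum_{r \in \mathbb{N}} \mathfrak{a}^{(r)} t^r$ of $R[t]$, where $t$ is an indeterminate and $\mathbb{N} = \{0,1,2,\dots\}$. Finitely generated means finitely generated as an algebra over the base ring (here $S$). *)

theory Defs
  imports
    "HOL-Algebra.Algebra"
    "HOL-Algebra.Algebraic_Closure_Type"
    "HOL-Computational_Algebra.Computational_Algebra"
    "HOL-Library.Extended_Nat"
begin

text \<open>Rings are handled as types; the library's locale-based notions (ideals, quotients,
  generated subrings, ideal products) are applied to the record \<open>ring_of_type_algebra\<close>, whose
  carrier is the whole type.\<close>

abbreviation ideal_gen :: "'a::comm_ring_1 set \<Rightarrow> 'a set" where
  "ideal_gen Y \<equiv> Idl\<^bsub>ring_of_type_algebra\<^esub> Y"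

text \<open>The unit of the monoid of ideals is the whole ring, so the zeroth power is the unit ideal.\<close>

abbreviation ideal_pow :: "'a::comm_ring_1 set \<Rightarrow> nat \<Rightarrow> 'a set" where
  "ideal_pow I r \<equiv> I [^]\<^bsub>ideals_set ring_of_type_algebra\<^esub> r"

definition reduced_ring :: "('a, 'b) ring_scheme \<Rightarrow> bool" where
  "reduced_ring R \<longleftrightarrow>
     cring R \<and> (\<forall>a\<in>carrier R. \<forall>n::nat. a [^]\<^bsub>R\<^esub> n = \<zero>\<^bsub>R\<^esub> \<longrightarrow> a = \<zero>\<^bsub>R\<^esub>)"

text \<open>Supremum of the lengths of strict chains \<open>p 0 \<subset> \<dots> \<subset> p n\<close> of prime ideals. The zero ring,
  which has no primes, gets dimension 0 in this convention.\<close>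

definition krull_dim :: "('a, 'b) ring_scheme \<Rightarrow> enat" where
  "krull_dim R = Sup {enat n | n.
     \<exists>p :: nat \<Rightarrow> 'a set. (\<forall>i\<le>n. primeideal (p i) R) \<and> (\<forall>i<n. p i \<subset> p (Suc i))}"

definition minimal_primes :: "'a::comm_ring_1 set \<Rightarrow> 'a set set" where
  "minimal_primes \<aa> = {p. primeideal p ring_of_type_algebra \<and> \<aa> \<subseteq> p \<and>
     (\<forall>q. primeideal q ring_of_type_algebra \<longrightarrow> \<aa> \<subseteq> q \<longrightarrow> q \<subseteq> p \<longrightarrow> q = p)}"

text \<open>For a domain, the localization at a prime \<open>p\<close> is realised inside the fraction field.\<close>

definition local_ring :: "'a::idom set \<Rightarrow> 'a fract ring" where
  "local_ring p = ring_of_type_algebra\<lparr>carrier := {Fract a s | a s. s \<notin> p}\<rparr>"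

definition extend_local :: "'a::idom set \<Rightarrow> 'a set \<Rightarrow> 'a fract set" where
  "extend_local p I = Idl\<^bsub>local_ring p\<^esub> ((\<lambda>a. Fract a 1) ` I)"

definition symbolic_power :: "'a::idom set \<Rightarrow> nat \<Rightarrow> 'a set" where
  "symbolic_power \<aa> r =
     (\<Inter>p\<in>minimal_primes \<aa>. {a. Fract a 1 \<in> extend_local p (ideal_pow p r)})"

text \<open>A subset of \<open>R[t]\<close>, the polynomial ring \<open>'a poly\<close> over \<open>R = 'a\<close>.\<close>

definition symbolic_rees :: "'a::idom set \<Rightarrow> 'a poly set" where
  "symbolic_rees \<aa> = {F. \<forall>r. coeff F r \<in> symbolic_power \<aa> r}"

text \<open>\<open>B \<subseteq> R[t]\<close> is a finitely generated \<open>R\<close>-subalgebra; \<open>range (\<lambda>s. [:s:])\<close> is the image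
  of \<open>R\<close> in \<open>R[t]\<close>.\<close>

definition finitely_generated_algebra :: "'a::comm_ring_1 poly set \<Rightarrow> bool" where
  "finitely_generated_algebra B \<longleftrightarrow>
     (\<exists>G. finite G \<and> B = generate_ring ring_of_type_algebra (range (\<lambda>s. [:s:]) \<union> G))"

text \<open>\<open>K[x,y,z]\<close> is \<open>K[x][y][z]\<close>, with \<open>z\<close> the outermost variable.\<close>

type_synonym 'k poly3 = "'k poly poly poly"

definition const3 :: "'k::comm_ring_1 \<Rightarrow> 'k poly3" where
  "const3 a = [:[:[:a:]:]:]"

definition var_x :: "'k::comm_ring_1 poly3" where "var_x = [:[:[:0, 1:]:]:]"
definition var_y :: "'k::comm_ring_1 poly3" where "var_y = [:[:0, 1:]:]"
definition var_z :: "'k::comm_ring_1 poly3" where "var_z = [:0, 1:]"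

text \<open>\<open>coeff (coeff (coeff f k) j) i\<close> is the coefficient of \<open>x^i y^j z^k\<close>. The zero
  polynomial is homogeneous of every degree.\<close>

definition homogeneous :: "'k::comm_ring_1 poly3 \<Rightarrow> nat \<Rightarrow> bool" where
  "homogeneous f d \<longleftrightarrow> (\<forall>i j k. coeff (coeff (coeff f k) j) i \<noteq> 0 \<longrightarrow> i + j + k = d)"

definition proj_rel :: "'k::field \<times> 'k \<times> 'k \<Rightarrow> 'k \<times> 'k \<times> 'k \<Rightarrow> bool" where
  "proj_rel = (\<lambda>(a, b, c) (a', b', c'). (a, b, c) \<noteq> (0, 0, 0) \<and>
     (\<exists>u. u \<noteq> 0 \<and> a' = u * a \<and> b' = u * b \<and> c' = u * c))"

lemma proj_rel_part_equivp: "part_equivp (proj_rel :: 'a::field \<times> 'a \<times> 'a \<Rightarrow> _)"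
proof (rule part_equivpI)
  show "\<exists>v :: 'a \<times> 'a \<times> 'a. proj_rel v v"
    by (rule exI[of _ "(1, 0, 0)"]) (auto simp: proj_rel_def intro: exI[of _ 1])
  show "symp (proj_rel :: 'a \<times> 'a \<times> 'a \<Rightarrow> _)"
  proof (rule sympI)
    fix v w :: "'a \<times> 'a \<times> 'a"
    assume vw: "proj_rel v w"
    obtain a b c where v: "v = (a, b, c)" by (cases v)
    obtain u where "v \<noteq> (0, 0, 0)" "u \<noteq> 0" and w: "w = (u * a, u * b, u * c)"
      using vw by (cases w) (auto simp: proj_rel_def v)
    then show "proj_rel w v"
      unfolding w v proj_rel_def prod.case by - (intro conjI exI[of _ "inverse u"], auto)
  qed
  show "transp (proj_rel :: 'a \<times> 'a \<times> 'a \<Rightarrow> _)"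
  proof (rule transpI)
    fix v w t :: "'a \<times> 'a \<times> 'a"
    assume vw: "proj_rel v w" and wt: "proj_rel w t"
    obtain a b c where v: "v = (a, b, c)" by (cases v)
    obtain u where "v \<noteq> (0, 0, 0)" "u \<noteq> 0" and w: "w = (u * a, u * b, u * c)"
      using vw by (cases w) (auto simp: proj_rel_def v)
    moreover obtain u' where "u' \<noteq> 0" and t: "t = (u' * (u * a), u' * (u * b), u' * (u * c))"
      using wt by (cases t) (auto simp: proj_rel_def w)
    ultimately show "proj_rel v t"
      by (auto simp: proj_rel_def v t mult.assoc intro!: exI[of _ "u' * u"])
  qed
qed

quotient_type (overloaded) 'k proj_plane = "'k::field \<times> 'k \<times> 'k" / partial: proj_rel
  by (rule proj_rel_part_equivp)

definition minors :: "'k::field \<times> 'k \<times> 'k \<Rightarrow> 'k poly3 set" where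
  "minors = (\<lambda>(a, b, c).
     {var_x * const3 b - var_y * const3 a,
      var_x * const3 c - var_z * const3 a,
      var_y * const3 c - var_z * const3 b})"

lemma minors_subset_ideal:
  assumes "proj_rel v w" and I: "ideal I ring_of_type_algebra" and "minors v \<subseteq> I"
  shows "minors w \<subseteq> I"
proof -
  obtain a b c u where v: "v = (a, b, c)" and w: "w = (u * a, u * b, u * c)"
    using assms(1) by (cases v; cases w) (auto simp: proj_rel_def)
  have scale: "const3 u * h \<in> I" if "h \<in> I" for h
    using ideal.I_l_closed[OF I that, of "const3 u"] by (simp add: ring_of_type_algebra_def)
  have mult: "const3 (d * e) = const3 d * const3 e" for d e :: 'a
    by (simp add: const3_def)
  have "minors w = (\<lambda>h. const3 u * h) ` minors v"
    by (simp add: minors_def v w mult algebra_simps)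
  then show ?thesis
    using scale assms(3) by auto
qed

lift_definition point_ideal :: "'k::field proj_plane \<Rightarrow> 'k poly3 set"
  is "\<lambda>v. ideal_gen (minors v)"
proof -
  fix v w :: "'k \<times> 'k \<times> 'k"
  assume vw: "proj_rel v w"
  then have wv: "proj_rel w v"
    using part_equivp_symp[OF proj_rel_part_equivp] by blast
  have "minors v \<subseteq> I \<longleftrightarrow> minors w \<subseteq> I" if "ideal I ring_of_type_algebra" for I
    using minors_subset_ideal[OF vw that] minors_subset_ideal[OF wv that] by blast
  then show "ideal_gen (minors v) = ideal_gen (minors w)"
    unfolding genideal_def by (intro arg_cong[of _ _ Inter]) auto
qed

definition points_ideal :: "'k::field proj_plane set \<Rightarrow> 'k poly3 set" where
  "points_ideal H = (\<Inter>P\<in>H. point_ideal P)"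

end

theory Submission
  imports Defs "HOL-Library.Product_Plus"
begin

text \<open>In coordinates with \<open>A = (0:1:0)\<close> and \<open>B = (0:0:1)\<close>, the homogeneous polynomial \<open>f\<close> of degree \<open>m\<close>, having
  multiplicity \<open>m\<close> at \<open>A\<close>, is a binary form in \<open>x, z\<close>, that is, it defines lines through \<open>A\<close>; likewise \<open>g\<close>
  is a form in \<open>x, y\<close> and defines lines through \<open>B\<close>. The remaining two conditions say that the line
  \<open>x = 0\<close> through \<open>A\<close> and \<open>B\<close>, regarded as the line at infinity, is not among them. So the common zeros of \<open>f\<close> and \<open>g\<close> are the points
  \<open>(1:\<beta>:\<alpha>)\<close> of a finite grid \<open>T \<times> S\<close>, where \<open>z = \<alpha> x\<close> and \<open>y = \<beta> x\<close> are the distinct lines of \<open>f\<close> and \<open>g\<close>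
  (\<open>binary_form_zeros\<close>). Only \<open>H\<close> enters the symbolic Rees ring, so from here on \<open>f\<close> and \<open>g\<close> stand for
  the products of these distinct lines, and \<open>m\<close> and \<open>n\<close> for their numbers.

  Every \<open>I\<^sub>P\<close> is prime and generated by two of three linear coordinates, so its powers are primary and the
  \<open>r\<close>-th symbolic power of \<open>I\<^sub>H\<close> is the intersection of the \<open>r\<close>-th powers of the \<open>I\<^sub>P\<close>
  (\<open>symbolic_power_points_ideal\<close>): it consists of the polynomials that vanish to order \<open>r\<close> at every
  point of \<open>H\<close>.

  The heart of the matter is that this intersection is spanned over \<open>K\<close> by the products
  \<open>x\<^sup>h y\<^sup>i z\<^sup>j f\<^sup>a g\<^sup>b\<close> that obviously belong to it (\<open>in_monomial_span\<close>), namely those with \<open>r \<le> h + j + m a\<close> (the order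
  at \<open>A\<close>), \<open>r \<le> h + i + n b\<close> (the order at \<open>B\<close>) and \<open>r \<le> a + b\<close> (the order on the grid). To see this, divide an
  element \<open>F\<close> by \<open>f\<close>, which is monic in \<open>z\<close>: \<open>F = F\<^sub>0 + f F\<^sub>1\<close>. Being a form, \<open>f\<close> respects the orders at
  \<open>A\<close> and \<open>B\<close>. On each of the \<open>m\<close> lines \<open>z = \<alpha> x\<close> the remainder agrees with \<open>F\<close> and is thus divisible by \<open>g\<^sup>r\<close>;
  having \<open>z\<close>-degree less than \<open>m\<close>, it is itself divisible by \<open>g\<^sup>r\<close>, and the cofactor is described by
  its orders at \<open>A\<close> and \<open>B\<close>, which are visible on monomials. The quotient \<open>F\<^sub>1\<close> vanishes to
  order \<open>r - 1\<close> on the grid, and induction applies.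

  The exponent vectors \<open>(h, i, j, a, b, r)\<close> satisfying the three linear inequalities form a finitely
  generated monoid by Gordan's lemma (\<open>admissible_exponents_finite_generators\<close>), and the monomials
  belonging to generators of this monoid generate the symbolic Rees ring
  (\<open>finitely_generated_grid\<close>).\<close>

section \<open>Substitution homomorphisms\<close>

locale type_hom =
  fixes h :: "'a::comm_ring_1 \<Rightarrow> 'b::comm_ring_1"
  assumes add: "h (a + b) = h a + h b"
    and mult: "h (a * b) = h a * h b"
    and one: "h 1 = 1"
begin

lemma zero: "h 0 = 0"
  using add[of 0 0] by simp

lemma uminus: "h (- a) = - h a"
  using add[of a "- a"] by (simp add: zero eq_neg_iff_add_eq_0 add.commute)

lemma diff: "h (a - b) = h a - h b"
  using add[of a "- b"] by (simp add: uminus)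

lemma power: "h (a ^ n) = h a ^ n"
  by (induction n) (simp_all add: mult one)

lemma sum: "h (sum f I) = (\<Sum>i\<in>I. h (f i))"
  by (induction I rule: infinite_finite_induct) (simp_all add: add zero)

lemma prod: "h (prod f I) = (\<Prod>i\<in>I. h (f i))"
  by (induction I rule: infinite_finite_induct) (simp_all add: mult one)

lemmas hom_simps = add mult one zero uminus diff power

end

definition eval_hom :: "('a::comm_ring_1 \<Rightarrow> 'b::comm_ring_1) \<Rightarrow> 'b \<Rightarrow> 'a poly \<Rightarrow> 'b" where
  "eval_hom h b p = poly (map_poly h p) b"

lemma eval_hom_const: "h 0 = 0 \<Longrightarrow> eval_hom h b [:a:] = h a"
  by (cases "a = 0") (simp_all add: eval_hom_def map_poly_pCons)

lemma eval_hom_X: "type_hom h \<Longrightarrow> eval_hom h b [:0, 1:] = b"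
  by (simp add: eval_hom_def map_poly_pCons type_hom.zero type_hom.one)

lemma type_hom_eval_hom:
  assumes "type_hom h"
  shows "type_hom (eval_hom h b)"
proof -
  interpret h: type_hom h by fact
  have "map_poly h (p + q) = map_poly h p + map_poly h q" for p q
    by (rule poly_eqI) (simp add: coeff_map_poly h.zero h.add)
  moreover have "map_poly h (p * q) = map_poly h p * map_poly h q" for p q
    by (rule poly_eqI) (simp add: coeff_map_poly h.zero h.sum h.mult coeff_mult)
  ultimately show ?thesis
    by unfold_locales (simp_all add: eval_hom_def h.one)
qed

definition subst3 :: "('k::comm_ring_1 \<Rightarrow> 'r::comm_ring_1) \<Rightarrow> 'r \<Rightarrow> 'r \<Rightarrow> 'r \<Rightarrow> 'k poly3 \<Rightarrow> 'r" where
  "subst3 h U V W = eval_hom (eval_hom (eval_hom h U) V) W"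

lemma type_hom_subst3: "type_hom h \<Longrightarrow> type_hom (subst3 h U V W)"
  unfolding subst3_def by (intro type_hom_eval_hom)

lemma subst3_simps:
  assumes "type_hom h"
  shows "subst3 h U V W (const3 a) = h a" "subst3 h U V W var_x = U"
    "subst3 h U V W var_y = V" "subst3 h U V W var_z = W"
proof -
  note hom = assms type_hom_eval_hom[OF assms, of U]
    type_hom_eval_hom[OF type_hom_eval_hom[OF assms, of U], of V]
  note zero = hom[THEN type_hom.zero]
  show "subst3 h U V W (const3 a) = h a" "subst3 h U V W var_x = U"
    "subst3 h U V W var_y = V" "subst3 h U V W var_z = W"
    by (simp_all add: subst3_def const3_def var_x_def var_y_def var_z_def
        eval_hom_const eval_hom_X zero hom)
qed

text \<open>\<open>K[x,y,z]\<close> is generated as a ring by \<open>K\<close> and the variables; both the equality of homomorphisms and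
  congruences modulo an ideal are checked on these generators.\<close>

lemma poly3_induct [case_names const x y z add mult]:
  fixes F :: "'k::comm_ring_1 poly3"
  assumes const: "\<And>a. P (const3 a)"
    and x: "P var_x" and y: "P var_y" and z: "P var_z"
    and add: "\<And>F G. P F \<Longrightarrow> P G \<Longrightarrow> P (F + G)"
    and mult: "\<And>F G. P F \<Longrightarrow> P G \<Longrightarrow> P (F * G)"
  shows "P F"
proof -
  have 1: "P [:[:p:]:]" for p :: "'k poly"
  proof (induction p)
    case 0
    then show ?case using const[of 0] by (simp add: const3_def)
  next
    case (pCons a p)
    have "[:[:pCons a p:]:] = const3 a + var_x * [:[:p:]:]"
      by (simp add: const3_def var_x_def)
    then show ?case using add[OF const mult[OF x pCons(2)]] by simp
  qed
  have 2: "P [:p:]" for p :: "'k poly poly"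
  proof (induction p)
    case 0
    then show ?case using 1[of 0] by simp
  next
    case (pCons a p)
    have "[:pCons a p:] = [:[:a:]:] + var_y * [:p:]"
      by (simp add: var_y_def)
    then show ?case using add[OF 1 mult[OF y pCons(2)]] by simp
  qed
  show ?thesis
  proof (induction F)
    case 0
    then show ?case using 2[of 0] by simp
  next
    case (pCons a p)
    have "pCons a p = [:a:] + var_z * p"
      by (simp add: var_z_def)
    then show ?case using add[OF 2 mult[OF z pCons(2)]] by simp
  qed
qed

lemma type_hom_poly3_eqI:
  fixes \<phi> \<psi> :: "'k::comm_ring_1 poly3 \<Rightarrow> 'r::comm_ring_1"
  assumes "type_hom \<phi>" "type_hom \<psi>"
    and "\<And>a. \<phi> (const3 a) = \<psi> (const3 a)"
    and "\<phi> var_x = \<psi> var_x" "\<phi> var_y = \<psi> var_y" "\<phi> var_z = \<psi> var_z"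
  shows "\<phi> F = \<psi> F"
  by (induction F rule: poly3_induct)
    (simp_all add: assms type_hom.add[OF assms(1)] type_hom.add[OF assms(2)]
      type_hom.mult[OF assms(1)] type_hom.mult[OF assms(2)])

lemma type_hom_comp: "type_hom \<phi> \<Longrightarrow> type_hom \<psi> \<Longrightarrow> type_hom (\<lambda>F. \<phi> (\<psi> F))"
  by (simp add: type_hom_def)

lemma type_hom_id: "type_hom (\<lambda>F. F)"
  by (simp add: type_hom_def)

lemma const3_simps:
  "const3 (a + b) = const3 a + const3 b" "const3 (a * b) = const3 a * const3 b"
  "const3 1 = 1" "const3 0 = 0" "const3 (- a) = - const3 a" "const3 (a - b) = const3 a - const3 b"
  by (simp_all add: const3_def one_pCons)

lemma type_hom_const3: "type_hom const3"
  by unfold_locales (simp_all add: const3_simps)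

abbreviation endo3 :: "'k::comm_ring_1 poly3 \<Rightarrow> 'k poly3 \<Rightarrow> 'k poly3 \<Rightarrow> 'k poly3 \<Rightarrow> 'k poly3" where
  "endo3 \<equiv> subst3 const3"

lemmas type_hom_endo3 = type_hom_subst3[OF type_hom_const3]
lemmas endo3_simps = subst3_simps[OF type_hom_const3] type_hom.hom_simps[OF type_hom_endo3]

lemma endo3_inverse:
  assumes "endo3 U V W U' = var_x" "endo3 U V W V' = var_y" "endo3 U V W W' = var_z"
  shows "endo3 U V W (endo3 U' V' W' F) = F"
  by (rule type_hom_poly3_eqI)
    (simp_all add: type_hom_id type_hom_comp type_hom_endo3 endo3_simps assms)

section \<open>Ideals of a ring given as a type\<close>

lemma a_inv_type: "\<ominus>\<^bsub>ring_of_type_algebra\<^esub> a = (- a :: 'a::comm_ring_1)"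
proof -
  interpret R: ring "ring_of_type_algebra :: 'a ring" by (rule ring_from_type_algebra)
  show ?thesis by (rule R.minus_equality) (simp_all add: ring_of_type_algebra_def)
qed

lemma ideal_type_iff:
  "ideal I (ring_of_type_algebra :: 'a::comm_ring_1 ring) \<longleftrightarrow>
     0 \<in> I \<and> (\<forall>a\<in>I. \<forall>b\<in>I. a + b \<in> I) \<and> (\<forall>a\<in>I. \<forall>r. r * a \<in> I)"
proof
  assume "ideal I (ring_of_type_algebra :: 'a ring)"
  then interpret ideal I "ring_of_type_algebra :: 'a ring" .
  show "0 \<in> I \<and> (\<forall>a\<in>I. \<forall>b\<in>I. a + b \<in> I) \<and> (\<forall>a\<in>I. \<forall>r. r * a \<in> I)"
    using additive_subgroup.zero_closed[OF is_additive_subgroup]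
      additive_subgroup.a_closed[OF is_additive_subgroup] I_l_closed
    unfolding ring_of_type_algebra_def by simp
next
  assume I: "0 \<in> I \<and> (\<forall>a\<in>I. \<forall>b\<in>I. a + b \<in> I) \<and> (\<forall>a\<in>I. \<forall>r. r * a \<in> I)"
  have neg: "- a \<in> I" if "a \<in> I" for a
    using I that by (metis mult_minus1)
  interpret R: ring "ring_of_type_algebra :: 'a ring" by (rule ring_from_type_algebra)
  show "ideal I (ring_of_type_algebra :: 'a ring)"
  proof (rule idealI)
    show "subgroup I (add_monoid (ring_of_type_algebra :: 'a ring))"
    proof (rule R.add.subgroupI)
      show "\<ominus>\<^bsub>ring_of_type_algebra\<^esub> a \<in> I" if "a \<in> I" for a
        using neg[OF that] by (simp add: a_inv_type)
    qed (use I in \<open>auto simp: ring_of_type_algebra_def\<close>)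
  qed (use I R.ring_axioms in \<open>simp_all add: ring_of_type_algebra_def mult.commute\<close>)
qed

lemma ideal_gen_ideal: "ideal (ideal_gen Y) (ring_of_type_algebra :: 'a::comm_ring_1 ring)"
  by (rule ring.genideal_ideal) (simp_all add: ring_from_type_algebra, simp add: ring_of_type_algebra_def)

lemma ideal_gen_superset: "Y \<subseteq> ideal_gen Y"
  by (auto simp: genideal_def)

lemma ideal_gen_least:
  "ideal I ring_of_type_algebra \<Longrightarrow> Y \<subseteq> I \<Longrightarrow> ideal_gen Y \<subseteq> I"
  by (auto simp: genideal_def)

section \<open>Powers of an ideal with two generators\<close>

text \<open>The \<open>r\<close>-th power of the ideal \<open>(u, v)\<close>. Allowing exponents with \<open>k + l > r\<close> changes nothing, but
  makes products and the inclusions between the powers immediate.\<close>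

inductive_set pair_power :: "'a::comm_ring_1 \<Rightarrow> 'a \<Rightarrow> nat \<Rightarrow> 'a set" for u v :: 'a and r :: nat where
  zero: "0 \<in> pair_power u v r"
| gen: "r \<le> k + l \<Longrightarrow> h * u ^ k * v ^ l \<in> pair_power u v r"
| add: "F \<in> pair_power u v r \<Longrightarrow> G \<in> pair_power u v r \<Longrightarrow> F + G \<in> pair_power u v r"

lemma pair_power_0: "F \<in> pair_power u v 0"
  using pair_power.gen[of 0 0 0 F u v] by simp

lemma pair_power_mult:
  assumes "F \<in> pair_power u v r" "G \<in> pair_power u v s"
  shows "F * G \<in> pair_power u v (r + s)"
  using assms
proof (induction F rule: pair_power.induct)
  case zero
  then show ?case by (simp add: pair_power.zero)
next
  case (add F F')
  then show ?case by (simp add: pair_power.add distrib_right)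
next
  case (gen k l h)
  show ?case using gen(2)
  proof (induction G rule: pair_power.induct)
    case zero
    then show ?case by (simp add: pair_power.zero)
  next
    case (add G G')
    then show ?case by (simp add: pair_power.add distrib_left)
  next
    case (gen k' l' h')
    have "(h * h') * u ^ (k + k') * v ^ (l + l') \<in> pair_power u v (r + s)"
      by (rule pair_power.gen) (use gen \<open>r \<le> k + l\<close> in simp)
    then show ?case by (simp add: power_add mult_ac)
  qed
qed

lemma pair_power_scale: "F \<in> pair_power u v r \<Longrightarrow> h * F \<in> pair_power u v r"
  using pair_power_mult[OF pair_power_0, of F u v r h] by simp

lemma pair_power_antimono: "F \<in> pair_power u v r \<Longrightarrow> s \<le> r \<Longrightarrow> F \<in> pair_power u v s"
  by (induction F rule: pair_power.induct) (auto intro: pair_power.intros)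

lemma pair_power_power: "F \<in> pair_power u v r \<Longrightarrow> F ^ k \<in> pair_power u v (k * r)"
  by (induction k) (auto intro: pair_power_0 pair_power_mult)

lemma pair_power_generators: "u \<in> pair_power u v 1" "v \<in> pair_power u v 1"
  using pair_power.gen[of 1 1 0 1 u v] pair_power.gen[of 1 0 1 1 u v] by simp_all

lemma pair_power_uminus: "F \<in> pair_power u v r \<Longrightarrow> - F \<in> pair_power u v r"
  using pair_power_scale[of F u v r "- 1"] by simp

lemma pair_power_diff:
  "F \<in> pair_power u v r \<Longrightarrow> G \<in> pair_power u v r \<Longrightarrow> F - G \<in> pair_power u v r"
  using pair_power.add[OF _ pair_power_uminus] by fastforce

lemma ideal_pair_power: "ideal (pair_power u v r) ring_of_type_algebra"
  by (simp add: ideal_type_iff pair_power.zero pair_power.add pair_power_scale)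

lemma ideal_gen_pair: "ideal_gen {u, v} = pair_power u v 1"
proof
  show "ideal_gen {u, v} \<subseteq> pair_power u v 1"
    using pair_power_generators by (intro ideal_gen_least ideal_pair_power) auto
next
  have I: "0 \<in> ideal_gen {u, v}" "\<And>a b. a \<in> ideal_gen {u, v} \<Longrightarrow> b \<in> ideal_gen {u, v} \<Longrightarrow> a + b \<in> ideal_gen {u, v}"
    "\<And>a r. a \<in> ideal_gen {u, v} \<Longrightarrow> r * a \<in> ideal_gen {u, v}"
    using ideal_gen_ideal[of "{u, v}"] by (auto simp: ideal_type_iff)
  have uv: "u \<in> ideal_gen {u, v}" "v \<in> ideal_gen {u, v}"
    using ideal_gen_superset[of "{u, v}"] by auto
  show "pair_power u v 1 \<subseteq> ideal_gen {u, v}"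
  proof
    fix F assume "F \<in> pair_power u v 1"
    then show "F \<in> ideal_gen {u, v}"
    proof (induction F rule: pair_power.induct)
      case (gen k l h)
      show ?case
      proof (cases k)
        case 0
        then obtain l' where "l = Suc l'" using gen by (cases l) auto
        then show ?thesis using I(3)[OF uv(2), of "h * v ^ l'"] 0 by (simp add: mult_ac)
      next
        case (Suc k')
        then show ?thesis using I(3)[OF uv(1), of "h * u ^ k' * v ^ l"] by (simp add: mult_ac)
      qed
    qed (use I in auto)
  qed
qed

lemma ideal_pow_0: "ideal_pow I 0 = (UNIV :: 'a::comm_ring_1 set)"
  unfolding nat_pow_def ideals_set_def ring_of_type_algebra_def by simp

lemma ideal_pow_Suc:
  "ideal_pow I (Suc r) = ideal_prod ring_of_type_algebra (ideal_pow I r) (I :: 'a::comm_ring_1 set)"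
  by (simp add: ideals_set_def nat_pow_def)

lemma ideal_pow_pair_power: "ideal_pow (pair_power u v 1) r = pair_power u v r"
proof (induction r)
  case 0
  show ?case unfolding ideal_pow_0 by (auto intro: pair_power_0)
next
  case (Suc r)
  let ?J = "ideal_prod ring_of_type_algebra (pair_power u v r) (pair_power u v 1)"
  have prod: "i * j \<in> ?J" if "i \<in> pair_power u v r" "j \<in> pair_power u v 1" for i j
    using ideal_prod.prod[OF that, of ring_of_type_algebra] by (simp add: ring_of_type_algebra_def)
  have "F \<in> pair_power u v (Suc r)" if "F \<in> ?J" for F
    using that
  proof (induction F rule: ideal_prod.induct)
    case (prod i j)
    then show ?case using pair_power_mult[of i u v r j 1] by (simp add: ring_of_type_algebra_def)
  next
    case (sum s1 s2)
    then show ?case by (simp add: ring_of_type_algebra_def pair_power.add)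
  qed
  moreover have "F \<in> ?J" if "F \<in> pair_power u v (Suc r)" for F
    using that
  proof (induction F rule: pair_power.induct)
    case zero
    then show ?case using prod[OF pair_power.zero pair_power.zero] by simp
  next
    case (add F G)
    then show ?case using ideal_prod.sum[of F ring_of_type_algebra _ _ G]
      by (simp add: ring_of_type_algebra_def)
  next
    case (gen k l h)
    show ?case
    proof (cases k)
      case 0
      then obtain l' where l': "l = Suc l'" using gen by (cases l) auto
      have "h * u ^ k * v ^ l' \<in> pair_power u v r" by (rule pair_power.gen) (use gen 0 l' in simp)
      then have "h * u ^ k * v ^ l' * v \<in> ?J" by (rule prod) (rule pair_power_generators)
      then show ?thesis using l' by (simp add: mult_ac)
    next
      case (Suc k')
      have "h * u ^ k' * v ^ l \<in> pair_power u v r" by (rule pair_power.gen) (use gen Suc in simp)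
      then have "h * u ^ k' * v ^ l * u \<in> ?J" by (rule prod) (rule pair_power_generators)
      then show ?thesis using Suc by (simp add: mult_ac)
    qed
  qed
  ultimately show ?case by (simp only: ideal_pow_Suc Suc) blast
qed

lemma pair_power_image:
  assumes "type_hom \<sigma>" "F \<in> pair_power u v r"
  shows "\<sigma> F \<in> pair_power (\<sigma> u) (\<sigma> v) r"
  using assms(2)
  by (induction F rule: pair_power.induct)
    (auto simp: type_hom.hom_simps[OF assms(1)] intro: pair_power.intros)

section \<open>Monomials in three variables\<close>

lemma poly_monomial_induct:
  fixes p :: "'a::comm_ring_1 poly"
  assumes "P 0" and "\<And>p q. P p \<Longrightarrow> P q \<Longrightarrow> P (p + q)"
    and "\<And>i. coeff p i \<noteq> 0 \<Longrightarrow> P ([:coeff p i:] * [:0, 1:] ^ i)"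
  shows "P p"
proof -
  have "P (\<Sum>i\<in>I. monom (coeff p i) i)" if "finite I" for I
    using that
  proof (induction I rule: finite_induct)
    case (insert i I)
    have "P (monom (coeff p i) i)"
      using assms(1) assms(3)[of i] by (cases "coeff p i = 0") (simp_all add: monom_altdef)
    with insert show ?case by (simp add: assms(2))
  qed (simp add: assms(1))
  from this[of "{..degree p}"] show ?thesis
    by (simp add: poly_as_sum_of_monoms)
qed

lemma poly3_monomial_induct [case_names zero add monomial]:
  fixes F :: "'k::comm_ring_1 poly3"
  assumes zero: "P 0" and add: "\<And>F G. P F \<Longrightarrow> P G \<Longrightarrow> P (F + G)"
    and monomial: "\<And>i j k. coeff (coeff (coeff F k) j) i \<noteq> 0 \<Longrightarrow>
      P (const3 (coeff (coeff (coeff F k) j) i) * var_x ^ i * var_y ^ j * var_z ^ k)"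
  shows "P F"
proof (induction rule: poly_monomial_induct[where p = F])
  case (3 k)
  define G where "G = coeff F k"
  have "P ([:G:] * var_z ^ k)"
  proof (induction rule: poly_monomial_induct[where p = G])
    case (3 j)
    define Q where "Q = coeff G j"
    have "P ([:[:Q:]:] * var_y ^ j * var_z ^ k)"
    proof (induction rule: poly_monomial_induct[where p = Q])
      case (3 i)
      then show ?case using monomial[of k j i]
        by (simp add: G_def Q_def const3_def var_x_def poly_const_pow)
    next
      case (2 p q)
      have "[:[:p + q:]:] = [:[:p:]:] + [:[:q:]:]" by simp
      with 2 show ?case by (simp only: distrib_right add)
    qed (simp add: zero)
    then show ?case by (simp add: Q_def var_y_def poly_const_pow mult.assoc)
  next
    case (2 p q)
    have "[:p + q:] = [:p:] + [:q:]" by simp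
    with 2 show ?case by (simp only: distrib_right add)
  qed (simp add: zero)
  then show ?case by (simp add: G_def var_z_def)
qed (simp_all add: zero add)

lemma var_x_power: "var_x ^ n = [:[:monom 1 n:]:]"
  by (simp add: var_x_def poly_const_pow monom_altdef)

lemma var_y_power: "var_y ^ n = [:monom 1 n:]"
  by (simp add: var_y_def poly_const_pow monom_altdef)

lemma var_z_power: "var_z ^ n = monom 1 n"
  by (simp add: var_z_def monom_altdef)

lemma pair_power_xz_iff:
  "F \<in> pair_power var_x var_z p \<longleftrightarrow>
     (\<forall>i j k. i + k < p \<longrightarrow> coeff (coeff (coeff F k) j) i = 0)"
proof
  assume "F \<in> pair_power var_x var_z p"
  then show "\<forall>i j k. i + k < p \<longrightarrow> coeff (coeff (coeff F k) j) i = 0"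
  proof (induction F rule: pair_power.induct)
    case (gen k l h)
    have "h * var_x ^ k * var_z ^ l = monom 1 l * smult [:monom 1 k:] h"
      by (simp add: var_x_power var_z_power mult_ac)
    then show ?case using gen by (auto simp: coeff_monom_mult)
  qed simp_all
next
  assume F: "\<forall>i j k. i + k < p \<longrightarrow> coeff (coeff (coeff F k) j) i = 0"
  show "F \<in> pair_power var_x var_z p"
  proof (rule poly3_monomial_induct[where F = F])
    fix i j k assume "coeff (coeff (coeff F k) j) i \<noteq> 0"
    then have "p \<le> i + k" using F by (meson not_le)
    from pair_power.gen[OF this, of "const3 (coeff (coeff (coeff F k) j) i) * var_y ^ j" var_x var_z]
    show "const3 (coeff (coeff (coeff F k) j) i) * var_x ^ i * var_y ^ j * var_z ^ k
        \<in> pair_power var_x var_z p"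
      by (simp add: mult_ac)
  qed (simp_all add: pair_power.zero pair_power.add)
qed

lemma pair_power_xy_iff:
  "F \<in> pair_power var_x var_y q \<longleftrightarrow>
     (\<forall>i j k. i + j < q \<longrightarrow> coeff (coeff (coeff F k) j) i = 0)"
proof
  assume "F \<in> pair_power var_x var_y q"
  then show "\<forall>i j k. i + j < q \<longrightarrow> coeff (coeff (coeff F k) j) i = 0"
  proof (induction F rule: pair_power.induct)
    case (gen k l h)
    have "h * var_x ^ k * var_y ^ l = smult (monom 1 l) (smult [:monom 1 k:] h)"
      by (simp add: var_x_power var_y_power mult_ac)
    then show ?case using gen by (auto simp: coeff_monom_mult)
  qed simp_all
next
  assume F: "\<forall>i j k. i + j < q \<longrightarrow> coeff (coeff (coeff F k) j) i = 0"
  show "F \<in> pair_power var_x var_y q"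
  proof (rule poly3_monomial_induct[where F = F])
    fix i j k assume "coeff (coeff (coeff F k) j) i \<noteq> 0"
    then have "q \<le> i + j" using F by (meson not_le)
    from pair_power.gen[OF this, of "const3 (coeff (coeff (coeff F k) j) i) * var_z ^ k" var_x var_y]
    show "const3 (coeff (coeff (coeff F k) j) i) * var_x ^ i * var_y ^ j * var_z ^ k
        \<in> pair_power var_x var_y q"
      by (simp add: mult_ac)
  qed (simp_all add: pair_power.zero pair_power.add)
qed

section \<open>Primary powers\<close>

lemma prime_elem_power_dvd_cancel:
  fixes u :: "'a::idom"
  assumes "prime_elem u" "\<not> u dvd a" "u ^ e dvd a * b"
  shows "u ^ e dvd b"
  using assms(3)
proof (induction e arbitrary: b)
  case (Suc e)
  have "u dvd a * b" using Suc.prems by (simp only: power_Suc) (rule dvd_mult_left)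
  then obtain c where c: "b = u * c" using assms(1,2) prime_elem_dvd_mult_iff by blast
  have "u * u ^ e dvd u * (a * c)" using Suc.prems by (simp add: c mult_ac)
  then have "u ^ e dvd a * c" using prime_elem_not_zeroI[OF assms(1)]
    by (simp only: dvd_mult_cancel_left) simp
  then have "u ^ e dvd c" by (rule Suc.IH)
  then show ?case unfolding c power_Suc by (rule mult_dvd_mono[OF dvd_refl])
qed simp

abbreviation coord_x :: "'k::comm_ring_1 poly poly" where
  "coord_x \<equiv> [:[:0, 1:]:]"

lemma coord_x_power: "coord_x ^ e = [:monom 1 e:]"
  by (simp add: poly_const_pow monom_altdef)

lemma prime_elem_coord_x: "prime_elem (coord_x :: 'k::field poly poly)"
  by (intro lift_prime_elem_poly prime_elem_linear_field_poly) simp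

lemma pair_power_xz_dvd_iff:
  fixes F :: "'k::field poly3"
  shows "F \<in> pair_power var_x var_z p \<longleftrightarrow> (\<forall>k. coord_x ^ (p - k) dvd coeff F k)"
proof -
  have "coord_x ^ e dvd q \<longleftrightarrow> (\<forall>i j. i < e \<longrightarrow> coeff (coeff q j) i = 0)" for e and q :: "'k poly poly"
    unfolding coord_x_power const_poly_dvd_iff monom_1_dvd_iff' by auto
  then show ?thesis
    unfolding pair_power_xz_iff by (simp add: less_diff_conv) blast
qed

text \<open>Compare coefficients of \<open>z\<^sup>k\<close> by induction on \<open>k\<close>: modulo the required power of \<open>x\<close>, all but
  one summand of the \<open>k\<close>-th coefficient of \<open>G F\<close> vanish, and the remaining one is the
  \<open>k\<close>-th coefficient of \<open>F\<close> times a factor prime to \<open>x\<close>.\<close>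

lemma pair_power_xz_primary:
  fixes F G :: "'k::field poly3"
  assumes "G \<notin> pair_power var_x var_z 1" and GF: "G * F \<in> pair_power var_x var_z r"
  shows "F \<in> pair_power var_x var_z r"
  unfolding pair_power_xz_dvd_iff
proof
  let ?x = "coord_x :: 'k poly poly"
  have G: "\<not> ?x dvd coeff G 0"
  proof
    assume "?x dvd coeff G 0"
    then have "\<forall>k. ?x ^ (1 - k) dvd coeff G k" 
      by (metis One_nat_def cancel_comm_monoid_add_class.diff_zero diff_Suc_Suc diff_0_eq_0 not0_implies_Suc power_0 power_one_right one_dvd)
    then show False using assms(1) by (simp add: pair_power_xz_dvd_iff)
  qed
  have cancel: "d dvd a" if "c = a + b" "d dvd c" "d dvd b" for a b c d :: "'k poly poly"
    using that dvd_add_left_iff by blast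
  fix k
  show "?x ^ (r - k) dvd coeff F k"
  proof (induction k rule: less_induct)
    case (less k)
    have "coeff (G * F) k = coeff G 0 * coeff F k + (\<Sum>l=1..k. coeff G l * coeff F (k - l))"
      unfolding coeff_mult by (subst atMost_atLeast0, subst sum.atLeast_Suc_atMost) simp_all
    moreover have "?x ^ (r - k) dvd coeff (G * F) k"
      using GF pair_power_xz_dvd_iff by blast
    moreover have "?x ^ (r - k) dvd (\<Sum>l=1..k. coeff G l * coeff F (k - l))"
    proof (rule dvd_sum)
      fix l assume "l \<in> {1..k}"
      then have "?x ^ (r - (k - l)) dvd coeff F (k - l)" using less[of "k - l"] by simp
      moreover have "?x ^ (r - k) dvd ?x ^ (r - (k - l))" by (rule le_imp_power_dvd) simp
      ultimately show "?x ^ (r - k) dvd coeff G l * coeff F (k - l)"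
        by (intro dvd_mult) (rule dvd_trans)
    qed
    ultimately have "?x ^ (r - k) dvd coeff G 0 * coeff F k"
      by (rule cancel)
    then show ?case by (rule prime_elem_power_dvd_cancel[OF prime_elem_coord_x G])
  qed
qed

text \<open>Multiplication by \<open>z\<close> is injective on the graded ring of the ideal \<open>(x, z)\<close>.\<close>

lemma pair_power_xz_cancel:
  assumes "var_z * G \<in> pair_power var_x var_z (Suc r)"
  shows "G \<in> pair_power var_x var_z r"
  unfolding pair_power_xz_iff
proof (intro allI impI)
  fix i j k assume "i + k < r"
  then have "coeff (coeff (coeff (var_z * G) (Suc k)) j) i = 0"
    using assms pair_power_xz_iff[of "var_z * G" "Suc r"] by simp
  then show "coeff (coeff (coeff G k) j) i = 0" by (simp add: var_z_def)
qed

text \<open>\<open>pair_power_xz_primary\<close> and \<open>pair_power_xz_cancel\<close> carry over to every pair of elements that some automorphism of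
  \<open>K[x,y,z]\<close> carries to \<open>x\<close> and \<open>z\<close>.\<close>

definition coordinate_pair :: "'k::comm_ring_1 poly3 \<Rightarrow> 'k poly3 \<Rightarrow> bool" where
  "coordinate_pair u v \<longleftrightarrow> (\<exists>\<sigma> :: 'k poly3 \<Rightarrow> 'k poly3. type_hom \<sigma> \<and> bij \<sigma> \<and> \<sigma> var_x = u \<and> \<sigma> var_z = v)"

lemma type_hom_inv:
  assumes "type_hom \<sigma>" "bij \<sigma>"
  shows "type_hom (inv_into UNIV \<sigma>)"
proof -
  interpret type_hom \<sigma> by fact
  have *: "inv_into UNIV \<sigma> a = b \<longleftrightarrow> a = \<sigma> b" for a b
    using assms(2) by (metis bij_inv_eq_iff)
  have **: "\<sigma> (inv_into UNIV \<sigma> a) = a" for a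
    using assms(2) by (simp add: bij_is_surj surj_f_inv_f)
  show ?thesis by unfold_locales (simp_all add: * ** add mult one)
qed

lemma pair_power_bij_iff:
  assumes "type_hom \<sigma>" "bij \<sigma>"
  shows "\<sigma> F \<in> pair_power (\<sigma> u) (\<sigma> v) r \<longleftrightarrow> F \<in> pair_power u v r"
  using pair_power_image[OF assms(1), of F u v r]
    pair_power_image[OF type_hom_inv[OF assms], of "\<sigma> F" "\<sigma> u" "\<sigma> v" r] assms(2)
  by (auto simp: bij_is_inj)

lemma coordinate_pair_primary:
  fixes F G :: "'k::field poly3"
  assumes "coordinate_pair u v" "G \<notin> pair_power u v 1" "G * F \<in> pair_power u v r"
  shows "F \<in> pair_power u v r"
proof -
  obtain \<sigma> :: "'k poly3 \<Rightarrow> 'k poly3" where \<sigma>: "type_hom \<sigma>" "bij \<sigma>" and uv: "u = \<sigma> var_x" "v = \<sigma> var_z"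
    using assms(1) by (auto simp: coordinate_pair_def)
  obtain F' G' where FG: "F = \<sigma> F'" "G = \<sigma> G'"
    using \<sigma>(2) by (meson bij_pointE)
  have "G' * F' \<in> pair_power var_x var_z r" "G' \<notin> pair_power var_x var_z 1"
    using assms(2,3) unfolding FG uv type_hom.mult[OF \<sigma>(1), symmetric] pair_power_bij_iff[OF \<sigma>]
    by simp_all
  then have "F' \<in> pair_power var_x var_z r" using pair_power_xz_primary by blast
  then show ?thesis unfolding FG uv pair_power_bij_iff[OF \<sigma>] .
qed

lemma coordinate_pair_cancel:
  fixes G :: "'k::comm_ring_1 poly3"
  assumes "coordinate_pair u v" "v * G \<in> pair_power u v (Suc r)"
  shows "G \<in> pair_power u v r"
proof -
  obtain \<sigma> :: "'k poly3 \<Rightarrow> 'k poly3" where \<sigma>: "type_hom \<sigma>" "bij \<sigma>" and uv: "u = \<sigma> var_x" "v = \<sigma> var_z"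
    using assms(1) by (auto simp: coordinate_pair_def)
  obtain G' where G: "G = \<sigma> G'"
    using \<sigma>(2) by (meson bij_pointE)
  have "var_z * G' \<in> pair_power var_x var_z (Suc r)"
    using assms(2) unfolding G uv type_hom.mult[OF \<sigma>(1), symmetric] pair_power_bij_iff[OF \<sigma>] .
  then show ?thesis unfolding G uv pair_power_bij_iff[OF \<sigma>] by (rule pair_power_xz_cancel)
qed

lemma endo3_bij:
  fixes U V W U' V' W' :: "'k::comm_ring_1 poly3"
  assumes "\<And>F. endo3 U V W (endo3 U' V' W' F) = F" "\<And>F. endo3 U' V' W' (endo3 U V W F) = F"
  shows "bij (endo3 U V W)"
  by (rule o_bij[of "endo3 U' V' W'"]) (simp_all add: fun_eq_iff assms)

section \<open>Points and linear changes of coordinates\<close>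

definition dot3 :: "'k::comm_ring_1 \<times> 'k \<times> 'k \<Rightarrow> 'k \<times> 'k \<times> 'k \<Rightarrow> 'k" where
  "dot3 = (\<lambda>(a, b, c) (a', b', c'). a * a' + b * b' + c * c')"

definition cross3 :: "'k::comm_ring_1 \<times> 'k \<times> 'k \<Rightarrow> 'k \<times> 'k \<times> 'k \<Rightarrow> 'k \<times> 'k \<times> 'k" where
  "cross3 = (\<lambda>(a, b, c) (a', b', c'). (b * c' - c * b', c * a' - a * c', a * b' - b * a'))"

definition linear_form :: "'k::comm_ring_1 \<times> 'k \<times> 'k \<Rightarrow> 'k poly3" where
  "linear_form = (\<lambda>(a, b, c). const3 a * var_x + const3 b * var_y + const3 c * var_z)"

text \<open>The restriction of a polynomial to the line \<open>s \<mapsto> s v\<close> through the origin. Its kernel is the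
  ideal of the point of the projective plane that a nonzero \<open>v\<close> represents, which is therefore prime.\<close>

definition restrict_line :: "'k::comm_ring_1 \<times> 'k \<times> 'k \<Rightarrow> 'k poly3 \<Rightarrow> 'k poly" where
  "restrict_line = (\<lambda>(a, b, c). subst3 (\<lambda>e. [:e:]) [:0, a:] [:0, b:] [:0, c:])"

lemma type_hom_const_poly: "type_hom (\<lambda>e. [:e:])"
  by unfold_locales (simp_all add: one_pCons)

lemma type_hom_restrict_line: "type_hom (restrict_line v)"
  by (cases v) (simp add: restrict_line_def type_hom_subst3 type_hom_const_poly)

lemma restrict_line_linear_form: "restrict_line v (linear_form l) = [:0, dot3 l v:]"
  by (cases v; cases l)
    (simp add: restrict_line_def linear_form_def dot3_def subst3_simps[OF type_hom_const_poly]
      type_hom.hom_simps[OF type_hom_subst3[OF type_hom_const_poly]])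

lemma restrict_line_const3: "restrict_line v (const3 e) = [:e:]"
  by (cases v) (simp add: restrict_line_def subst3_simps[OF type_hom_const_poly])

lemma restrict_line_vars:
  "restrict_line (a, b, c) var_x = [:0, a:]" "restrict_line (a, b, c) var_y = [:0, b:]"
  "restrict_line (a, b, c) var_z = [:0, c:]"
  by (simp_all add: restrict_line_def subst3_simps[OF type_hom_const_poly])

lemma exists_dot3_eq_1:
  fixes v :: "'k::field \<times> 'k \<times> 'k"
  assumes "v \<noteq> (0, 0, 0)"
  shows "\<exists>l. dot3 l v = 1"
proof -
  obtain a b c where v: "v = (a, b, c)" by (cases v)
  consider "a \<noteq> 0" | "b \<noteq> 0" | "c \<noteq> 0" using assms v by auto
  then show ?thesis
  proof cases
    case 1
    then show ?thesis by (intro exI[of _ "(1 / a, 0, 0)"]) (simp add: v dot3_def)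
  next
    case 2
    then show ?thesis by (intro exI[of _ "(0, 1 / b, 0)"]) (simp add: v dot3_def)
  next
    case 3
    then show ?thesis by (intro exI[of _ "(0, 0, 1 / c)"]) (simp add: v dot3_def)
  qed
qed

text \<open>If \<open>L\<close> is a linear form with \<open>L(v) = 1\<close>, then \<open>x \<equiv> a L\<close>, \<open>y \<equiv> b L\<close> and \<open>z \<equiv> c L\<close> modulo the
  minors, so every \<open>F\<close> is congruent to its restriction to the line, evaluated at \<open>L\<close>.\<close>

lemma ideal_gen_minors:
  fixes v :: "'k::field \<times> 'k \<times> 'k"
  assumes "v \<noteq> (0, 0, 0)"
  shows "ideal_gen (minors v) = {F. restrict_line v F = 0}"
proof
  obtain a b c where v: "v = (a, b, c)" by (cases v)
  interpret h: type_hom "restrict_line v" by (rule type_hom_restrict_line)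
  show "ideal_gen (minors v) \<subseteq> {F. restrict_line v F = 0}"
  proof (rule ideal_gen_least)
    show "ideal {F. restrict_line v F = 0} ring_of_type_algebra"
      by (simp add: ideal_type_iff h.hom_simps)
    have "restrict_line v var_x = [:0, a:]" "restrict_line v var_y = [:0, b:]"
      "restrict_line v var_z = [:0, c:]"
      by (simp_all add: v restrict_line_vars)
    then show "minors v \<subseteq> {F. restrict_line v F = 0}"
      by (auto simp: minors_def v type_hom.hom_simps[OF type_hom_restrict_line] restrict_line_const3)
  qed
  let ?I = "ideal_gen (minors v)"
  have I: "0 \<in> ?I" "\<And>p q. p \<in> ?I \<Longrightarrow> q \<in> ?I \<Longrightarrow> p + q \<in> ?I" "\<And>p r. p \<in> ?I \<Longrightarrow> r * p \<in> ?I"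
    using ideal_gen_ideal[of "minors v"] by (auto simp: ideal_type_iff)
  obtain l where "dot3 l v = 1" using exists_dot3_eq_1[OF assms] by blast
  moreover obtain d e f where l: "l = (d, e, f)" by (cases l)
  ultimately have 1: "1 = d * a + e * b + f * c" by (simp add: dot3_def v)
  define L where "L = linear_form l"
  have 13: "const3 d * const3 a + const3 e * const3 b + const3 f * const3 c = 1"
    by (simp add: const3_simps[symmetric] 1[symmetric])
  have "var_x * const3 b - var_y * const3 a \<in> ?I" "var_x * const3 c - var_z * const3 a \<in> ?I"
    "var_y * const3 c - var_z * const3 b \<in> ?I"
    using ideal_gen_superset[of "minors v"] by (auto simp: minors_def v)
  note m = this
  have "var_x - const3 a * L = const3 e * (var_x * const3 b - var_y * const3 a) +
      const3 f * (var_x * const3 c - var_z * const3 a)"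
    using arg_cong[OF 13, of "\<lambda>t. var_x * t"] by (simp add: L_def linear_form_def l algebra_simps)
  then have x: "var_x - const3 a * L \<in> ?I" by (simp add: I m)
  have "var_y - const3 b * L = (- const3 d) * (var_x * const3 b - var_y * const3 a) +
      const3 f * (var_y * const3 c - var_z * const3 b)"
    using arg_cong[OF 13, of "\<lambda>t. var_y * t"] by (simp add: L_def linear_form_def l algebra_simps)
  then have y: "var_y - const3 b * L \<in> ?I" by (simp only: I m)
  have "var_z - const3 c * L = (- const3 d) * (var_x * const3 c - var_z * const3 a) +
      (- const3 e) * (var_y * const3 c - var_z * const3 b)"
    using arg_cong[OF 13, of "\<lambda>t. var_z * t"] by (simp add: L_def linear_form_def l algebra_simps)
  then have z: "var_z - const3 c * L \<in> ?I" by (simp only: I m)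
  define \<phi> where "\<phi> p = eval_hom const3 L p" for p
  have \<phi>: "type_hom \<phi>" "\<And>e. \<phi> [:e:] = const3 e" "\<And>e. \<phi> [:0, e:] = const3 e * L"
    unfolding \<phi>_def by (simp_all add: type_hom_eval_hom type_hom_const3 eval_hom_const const3_simps)
      (simp add: eval_hom_def map_poly_pCons const3_simps)
  have congr: "F - \<phi> (restrict_line v F) \<in> ?I" for F
  proof (induction F rule: poly3_induct)
    case (add F G)
    have "F + G - \<phi> (restrict_line v (F + G)) =
        (F - \<phi> (restrict_line v F)) + (G - \<phi> (restrict_line v G))"
      by (simp add: h.add type_hom.add[OF \<phi>(1)])
    then show ?case using I(2)[OF add] by (simp only:)
  next
    case (mult F G)
    have "F * G - \<phi> (restrict_line v (F * G)) =
        G * (F - \<phi> (restrict_line v F)) + \<phi> (restrict_line v F) * (G - \<phi> (restrict_line v G))"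
      by (simp add: h.mult type_hom.mult[OF \<phi>(1)] algebra_simps)
    then show ?case using mult by (simp add: I)
  qed (simp_all add: v restrict_line_vars restrict_line_const3 \<phi> x y z[unfolded v] I x[unfolded v] y[unfolded v] I[unfolded v])
  show "{F. restrict_line v F = 0} \<subseteq> ?I"
  proof
    fix F assume "F \<in> {F. restrict_line v F = 0}"
    then show "F \<in> ?I" using congr[of F] by (simp add: type_hom.zero[OF \<phi>(1)])
  qed
qed

text \<open>Again with a form \<open>L\<close> such that \<open>L(v) = 1\<close>: if the cross product vanishes, then \<open>w = L(w) v\<close>.\<close>

lemma cross3_nonzero:
  fixes v w :: "'k::field \<times> 'k \<times> 'k"
  assumes "v \<noteq> (0, 0, 0)" "w \<noteq> (0, 0, 0)" "\<not> proj_rel v w"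
  shows "cross3 v w \<noteq> (0, 0, 0)"
proof
  obtain a b c where v: "v = (a, b, c)" by (cases v)
  obtain a' b' c' where w: "w = (a', b', c')" by (cases w)
  assume "cross3 v w = (0, 0, 0)"
  then have eqs: "b * c' = c * b'" "c * a' = a * c'" "a * b' = b * a'"
    by (auto simp: cross3_def v w)
  obtain l where "dot3 l v = 1" using exists_dot3_eq_1[OF assms(1)] by blast
  moreover obtain d e f where l: "l = (d, e, f)" by (cases l)
  ultimately have 1: "d * a + e * b + f * c = 1" by (simp add: dot3_def v)
  define u where "u = d * a' + e * b' + f * c'"
  have "u * a = d * (a * a') + e * (a * b') + f * (a * c')" by (simp add: u_def algebra_simps)
  also have "\<dots> = a' * (d * a + e * b + f * c)" by (simp only: eqs(3) eqs(2)[symmetric]) (simp add: algebra_simps)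
  finally have a: "u * a = a' * (d * a + e * b + f * c)" .
  have "u * b = d * (b * a') + e * (b * b') + f * (b * c')" by (simp add: u_def algebra_simps)
  also have "\<dots> = b' * (d * a + e * b + f * c)" by (simp only: eqs(1) eqs(3)[symmetric]) (simp add: algebra_simps)
  finally have b: "u * b = b' * (d * a + e * b + f * c)" .
  have "u * c = d * (c * a') + e * (c * b') + f * (c * c')" by (simp add: u_def algebra_simps)
  also have "\<dots> = c' * (d * a + e * b + f * c)" by (simp only: eqs(2) eqs(1)[symmetric]) (simp add: algebra_simps)
  finally have c: "u * c = c' * (d * a + e * b + f * c)" .
  then have "a' = u * a" "b' = u * b" "c' = u * c" using a b c by (simp_all add: 1)
  then have "proj_rel v w" using assms(1,2) by (auto simp: proj_rel_def v w)
  then show False using assms(3) by simp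
qed

text \<open>Coordinates in which two given points become \<open>(0:1:0)\<close> and \<open>(0:0:1)\<close>: the basis \<open>c, a, b\<close> of
  \<open>K\<^sup>3\<close>, where \<open>c\<close> is chosen with determinant \<open>1\<close>, has the cross products as its dual basis.\<close>

lemma exists_dual_basis:
  fixes a b :: "'k::field \<times> 'k \<times> 'k"
  assumes "cross3 a b \<noteq> (0, 0, 0)"
  obtains \<xi> \<eta> \<zeta> where
    "dot3 \<xi> a = 0" "dot3 \<xi> b = 0" "dot3 \<eta> a = 1" "dot3 \<eta> b = 0" "dot3 \<zeta> a = 0" "dot3 \<zeta> b = 1"
    "bij (endo3 (linear_form \<xi>) (linear_form \<eta>) (linear_form \<zeta>))"
    "\<And>\<beta> \<alpha>. \<exists>w. dot3 \<xi> w = 1 \<and> dot3 \<eta> w = \<beta> \<and> dot3 \<zeta> w = \<alpha>"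
    "\<And>w. dot3 \<xi> w = 0 \<Longrightarrow> dot3 \<eta> w = 0 \<Longrightarrow> dot3 \<zeta> w = 0 \<Longrightarrow> w = (0, 0, 0)"
proof -
  obtain c where det: "dot3 c (cross3 a b) = 1" using exists_dot3_eq_1[OF assms] by blast
  obtain a1 a2 a3 where a: "a = (a1, a2, a3)" by (cases a)
  obtain b1 b2 b3 where b: "b = (b1, b2, b3)" by (cases b)
  obtain c1 c2 c3 where c: "c = (c1, c2, c3)" by (cases c)
  obtain x1 x2 x3 where \<xi>: "cross3 a b = (x1, x2, x3)" by (cases "cross3 a b")
  obtain y1 y2 y3 where \<eta>: "cross3 b c = (y1, y2, y3)" by (cases "cross3 b c")
  obtain z1 z2 z3 where \<zeta>: "cross3 c a = (z1, z2, z3)" by (cases "cross3 c a")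
  have d: "c1 * x1 + c2 * x2 + c3 * x3 = 1" using det by (simp add: dot3_def c \<xi>)
  have defs: "x1 = a2 * b3 - a3 * b2" "x2 = a3 * b1 - a1 * b3" "x3 = a1 * b2 - a2 * b1"
    "y1 = b2 * c3 - b3 * c2" "y2 = b3 * c1 - b1 * c3" "y3 = b1 * c2 - b2 * c1"
    "z1 = c2 * a3 - c3 * a2" "z2 = c3 * a1 - c1 * a3" "z3 = c1 * a2 - c2 * a1"
    using \<xi> \<eta> \<zeta> by (simp_all add: cross3_def a b c)
  have dual: "x1 * a1 + x2 * a2 + x3 * a3 = 0" "x1 * b1 + x2 * b2 + x3 * b3 = 0"
    "x1 * c1 + x2 * c2 + x3 * c3 = 1"
    "y1 * a1 + y2 * a2 + y3 * a3 = 1" "y1 * b1 + y2 * b2 + y3 * b3 = 0"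
    "y1 * c1 + y2 * c2 + y3 * c3 = 0"
    "z1 * a1 + z2 * a2 + z3 * a3 = 0" "z1 * b1 + z2 * b2 + z3 * b3 = 1"
    "z1 * c1 + z2 * c2 + z3 * c3 = 0"
    using d unfolding defs by (simp_all add: algebra_simps)
  have recon: "c1 * x1 + a1 * y1 + b1 * z1 = 1" "c1 * x2 + a1 * y2 + b1 * z2 = 0"
    "c1 * x3 + a1 * y3 + b1 * z3 = 0"
    "c2 * x1 + a2 * y1 + b2 * z1 = 0" "c2 * x2 + a2 * y2 + b2 * z2 = 1"
    "c2 * x3 + a2 * y3 + b2 * z3 = 0"
    "c3 * x1 + a3 * y1 + b3 * z1 = 0" "c3 * x2 + a3 * y2 + b3 * z2 = 0"
    "c3 * x3 + a3 * y3 + b3 * z3 = 1"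
    using d unfolding defs by (simp_all add: algebra_simps)
  have regroup: "r * (p1 * s1 + p2 * s2 + p3 * s3) + t * (q1 * s1 + q2 * s2 + q3 * s3) +
      u * (r1 * s1 + r2 * s2 + r3 * s3) = (r * p1 + t * q1 + u * r1) * s1 +
      (r * p2 + t * q2 + u * r2) * s2 + (r * p3 + t * q3 + u * r3) * s3"
    for r t u p1 p2 p3 q1 q2 q3 r1 r2 r3 s1 s2 s3 :: "'r::comm_ring_1"
    by (simp add: algebra_simps)
  note dual' = dual[THEN arg_cong[of _ _ const3], unfolded const3_simps]
  note recon' = recon[THEN arg_cong[of _ _ const3], unfolded const3_simps]
  let ?U = "linear_form (x1, x2, x3)" and ?V = "linear_form (y1, y2, y3)"
    and ?W = "linear_form (z1, z2, z3)"
  let ?U' = "linear_form (c1, a1, b1)" and ?V' = "linear_form (c2, a2, b2)"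
    and ?W' = "linear_form (c3, a3, b3)"
  have "endo3 ?U ?V ?W ?U' = var_x" "endo3 ?U ?V ?W ?V' = var_y" "endo3 ?U ?V ?W ?W' = var_z"
    unfolding linear_form_def prod.case endo3_simps regroup recon' by simp_all
  note inv1 = endo3_inverse[OF this]
  have "endo3 ?U' ?V' ?W' ?U = var_x" "endo3 ?U' ?V' ?W' ?V = var_y" "endo3 ?U' ?V' ?W' ?W = var_z"
    unfolding linear_form_def prod.case endo3_simps regroup dual' by simp_all
  note inv2 = endo3_inverse[OF this]
  show ?thesis
  proof (rule that[of "(x1, x2, x3)" "(y1, y2, y3)" "(z1, z2, z3)"])
    show "bij (endo3 ?U ?V ?W)" by (rule endo3_bij[OF inv1 inv2])
  next
    fix \<beta> \<alpha> :: 'k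
    have "dot3 (p, q, r) (c1 + \<beta> * a1 + \<alpha> * b1, c2 + \<beta> * a2 + \<alpha> * b2, c3 + \<beta> * a3 + \<alpha> * b3) =
        (p * c1 + q * c2 + r * c3) + \<beta> * (p * a1 + q * a2 + r * a3) + \<alpha> * (p * b1 + q * b2 + r * b3)"
      for p q r by (simp add: dot3_def algebra_simps)
    then show "\<exists>w. dot3 (x1, x2, x3) w = 1 \<and> dot3 (y1, y2, y3) w = \<beta> \<and> dot3 (z1, z2, z3) w = \<alpha>"
      by (intro exI[of _ "(c1 + \<beta> * a1 + \<alpha> * b1, c2 + \<beta> * a2 + \<alpha> * b2, c3 + \<beta> * a3 + \<alpha> * b3)"])
        (simp only: dual, simp)
  next
    fix w :: "'k \<times> 'k \<times> 'k"
    obtain w1 w2 w3 where w: "w = (w1, w2, w3)" by (cases w)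
    assume "dot3 (x1, x2, x3) w = 0" "dot3 (y1, y2, y3) w = 0" "dot3 (z1, z2, z3) w = 0"
    then have zero: "x1 * w1 + x2 * w2 + x3 * w3 = 0" "y1 * w1 + y2 * w2 + y3 * w3 = 0"
      "z1 * w1 + z2 * w2 + z3 * w3 = 0" by (simp_all add: dot3_def w)
    have "w1 = 0" using regroup[of c1 x1 w1 x2 w2 x3 w3 a1 y1 y2 y3 b1 z1 z2 z3]
      unfolding zero recon by simp
    moreover have "w2 = 0" using regroup[of c2 x1 w1 x2 w2 x3 w3 a2 y1 y2 y3 b2 z1 z2 z3]
      unfolding zero recon by simp
    moreover have "w3 = 0" using regroup[of c3 x1 w1 x2 w2 x3 w3 a3 y1 y2 y3 b3 z1 z2 z3]
      unfolding zero recon by simp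
    ultimately show "w = (0, 0, 0)" by (simp add: w)
  qed (use dual in \<open>simp_all add: dot3_def a b\<close>)
qed

lemma restrict_line_endo3:
  "restrict_line v (endo3 (linear_form \<xi>) (linear_form \<eta>) (linear_form \<zeta>) F) =
     restrict_line (dot3 \<xi> v, dot3 \<eta> v, dot3 \<zeta> v) F"
  by (rule type_hom_poly3_eqI)
    (simp_all add: type_hom_comp type_hom_restrict_line type_hom_endo3 endo3_simps
      restrict_line_const3 restrict_line_linear_form restrict_line_vars)

lemma restrict_line_kernel_standard:
  fixes F :: "'k::field poly3"
  shows "restrict_line (0, 1, 0) F = 0 \<longleftrightarrow> F \<in> pair_power var_x var_z 1"
    and "restrict_line (0, 0, 1) F = 0 \<longleftrightarrow> F \<in> pair_power var_x var_y 1"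
    and "restrict_line (1, \<beta>, \<alpha>) F = 0 \<longleftrightarrow>
      F \<in> pair_power (var_y - const3 \<beta> * var_x) (var_z - const3 \<alpha> * var_x) 1"
proof -
  have eq: "restrict_line v F = 0 \<longleftrightarrow> F \<in> pair_power s t 1"
    if "v \<noteq> (0, 0, 0)" "minors v \<subseteq> pair_power s t 1" "restrict_line v s = 0" "restrict_line v t = 0"
    for v and s t :: "'k poly3"
  proof -
    have "ideal_gen (minors v) \<subseteq> pair_power s t 1"
      by (intro ideal_gen_least ideal_pair_power that)
    moreover have "ideal {F. restrict_line v F = 0} ring_of_type_algebra"
      using ideal_gen_ideal[of "minors v"] by (simp add: ideal_gen_minors[OF that(1)])
    then have "ideal_gen {s, t} \<subseteq> {F. restrict_line v F = 0}"
      by (rule ideal_gen_least) (simp add: that)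
    ultimately show ?thesis unfolding ideal_gen_minors[OF that(1)] ideal_gen_pair by blast
  qed
  note pp = pair_power_generators pair_power.zero pair_power_uminus pair_power_diff pair_power_scale
  note rl = restrict_line_vars restrict_line_const3 type_hom.hom_simps[OF type_hom_restrict_line]
  show "restrict_line (0, 1, 0) F = 0 \<longleftrightarrow> F \<in> pair_power var_x var_z 1"
    by (rule eq) (auto simp: minors_def const3_simps rl intro!: pp[simplified])
  show "restrict_line (0, 0, 1) F = 0 \<longleftrightarrow> F \<in> pair_power var_x var_y 1"
    by (rule eq) (auto simp: minors_def const3_simps rl intro!: pp[simplified])
  let ?s = "var_y - const3 \<beta> * var_x" and ?t = "var_z - const3 \<alpha> * var_x"
  show "restrict_line (1, \<beta>, \<alpha>) F = 0 \<longleftrightarrow> F \<in> pair_power ?s ?t 1"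
  proof (rule eq)
    have "minors (1, \<beta>, \<alpha>) = {- ?s, - ?t, const3 \<alpha> * ?s - const3 \<beta> * ?t}"
      by (auto simp: minors_def const3_simps algebra_simps)
    then show "minors (1, \<beta>, \<alpha>) \<subseteq> pair_power ?s ?t 1"
      by (simp only: insert_subset empty_subsetI simp_thms) (intro conjI pp)
  qed (auto simp: rl)
qed

text \<open>The third coordinate that completes the pair is \<open>x\<close>.\<close>

lemma coordinate_pair_grid_point:
  fixes \<alpha> \<beta> :: "'k::field"
  shows "coordinate_pair (var_y - const3 \<beta> * var_x) (var_z - const3 \<alpha> * var_x)"
    (is "coordinate_pair ?s ?t")
proof -
  have "bij (endo3 ?s var_x ?t)"
    by (rule endo3_bij[of _ _ _ var_y "var_x + const3 \<beta> * var_y" "var_z + const3 \<alpha> * var_y"];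
      rule endo3_inverse) (simp_all add: endo3_simps)
  then show ?thesis
    unfolding coordinate_pair_def by (intro exI[of _ "endo3 ?s var_x ?t"]) (simp add: type_hom_endo3 endo3_simps)
qed

lemma point_ideal_abs:
  "v \<noteq> (0, 0, 0) \<Longrightarrow> point_ideal (abs_proj_plane v) = {F. restrict_line v F = 0}"
  by (subst point_ideal.abs_eq)
    (auto simp: eq_onp_def ideal_gen_minors proj_rel_def intro!: exI[of _ 1] split: prod.splits)

lemma proj_plane_cases:
  fixes P :: "'k::field proj_plane"
  obtains v where "v \<noteq> (0, 0, 0)" "P = abs_proj_plane v"
proof -
  obtain v where "P = abs_proj_plane v" "proj_rel v v"
    using Quotient_proj_plane unfolding Quotient_def by metis
  then show ?thesis by (intro that[of v]) (auto simp: proj_rel_def)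
qed

lemma abs_proj_plane_eq: "proj_rel v w \<Longrightarrow> abs_proj_plane v = abs_proj_plane w"
  using Quotient_proj_plane unfolding Quotient_def by metis

lemma point_kernel_transport:
  assumes "type_hom \<sigma>" "bij \<sigma>" and "\<And>F. restrict_line v (\<sigma> F) = restrict_line v' F"
    and "\<And>F. restrict_line v' F = 0 \<longleftrightarrow> F \<in> pair_power s t 1"
  shows "{F. restrict_line v F = 0} = pair_power (\<sigma> s) (\<sigma> t) 1"
proof (rule Set.set_eqI)
  fix F
  obtain G where "F = \<sigma> G" using assms(2) by (meson bij_pointE)
  then show "F \<in> {F. restrict_line v F = 0} \<longleftrightarrow> F \<in> pair_power (\<sigma> s) (\<sigma> t) 1"
    using assms(3,4) pair_power_bij_iff[OF assms(1,2)] by simp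
qed

section \<open>Polynomials vanishing to prescribed orders on a grid and at two points at infinity\<close>

text \<open>A version of Vandermonde elimination modulo an ideal: Newton interpolation peels off one node
  at a time, and the differences of nodes only have to be cancellable modulo the ideal.\<close>

lemma coeffs_in_ideal_if_values_in_ideal:
  fixes F :: "'a::comm_ring_1 poly"
  assumes "finite T"
    and D: "0 \<in> D" "\<And>a b. a \<in> D \<Longrightarrow> b \<in> D \<Longrightarrow> a + b \<in> D" "\<And>a r. a \<in> D \<Longrightarrow> r * a \<in> D"
    and cancel: "\<And>s t c. s \<in> T \<Longrightarrow> t \<in> T \<Longrightarrow> s \<noteq> t \<Longrightarrow> (s - t) * c \<in> D \<Longrightarrow> c \<in> D"
    and "\<And>t. t \<in> T \<Longrightarrow> poly F t \<in> D"
    and "\<And>k. card T \<le> k \<Longrightarrow> coeff F k = 0"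
  shows "coeff F k \<in> D"
  using assms(1,5-)
proof (induction T arbitrary: F k rule: finite_induct)
  case empty
  then show ?case by (simp add: D)
next
  case (insert t T)
  define G where "G = synthetic_div F t"
  have F: "F = [:- t, 1:] * G + [:poly F t:]"
    unfolding G_def by (rule synthetic_div_correct'[symmetric])
  have sub: "a - b \<in> D" if "a \<in> D" "b \<in> D" for a b
    using D(2)[OF that(1) D(3)[OF that(2), of "- 1"]] by simp
  have "coeff G j \<in> D" for j
  proof (rule insert.IH)
    fix s assume s: "s \<in> T"
    have "poly F s = (s - t) * poly G s + poly F t"
      by (subst F) (simp add: algebra_simps)
    then have "(s - t) * poly G s \<in> D"
      using sub[OF insert.prems(2)[of s] insert.prems(2)[of t]] s by simp
    then show "poly G s \<in> D"
      using insert.prems(1)[of s t] s insert.hyps by auto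
  next
    fix j assume j: "card T \<le> j"
    have deg: "degree F \<le> card T"
      using insert.prems(3) insert.hyps by (intro degree_le) auto
    show "coeff G j = 0"
    proof (cases "degree F = 0")
      case True
      then have "G = 0" by (simp add: G_def synthetic_div_eq_0_iff)
      then show ?thesis by simp
    next
      case False
      then have "degree G < j" using deg j by (simp add: G_def degree_synthetic_div)
      then show ?thesis by (rule coeff_eq_0)
    qed
  qed (use insert.prems in auto)
  note G = this
  have "coeff ([:- t, 1:] * G) k \<in> D"
    using G D(2)[OF D(3)[OF G, of "- t" k]] D(3)[OF G, of "- t" k]
    by (cases k) (auto simp: coeff_pCons)
  moreover have "coeff [:poly F t:] k \<in> D"
    using insert.prems(2)[of t] D(1) by (simp add: coeff_pCons split: nat.split)
  ultimately show ?case
    using D(2) by (subst F) (simp only: coeff_add)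
qed

lemma prime_elem_linear:
  fixes t :: "'a::idom"
  shows "prime_elem [:- t, 1:]"
proof (rule prime_elemI)
  show "\<not> [:- t, 1:] dvd 1"
  proof
    assume "[:- t, 1:] dvd 1"
    then have "poly 1 t = 0" using poly_eq_0_iff_dvd by blast
    then show False by simp
  qed
qed (simp_all add: poly_eq_0_iff_dvd[symmetric])

lemma prod_linear_power_dvd:
  fixes p :: "'a::idom poly"
  assumes "finite T" "\<And>t. t \<in> T \<Longrightarrow> [:- t, 1:] ^ s dvd p"
  shows "(\<Prod>t\<in>T. [:- t, 1:]) ^ s dvd p"
  using assms
proof (induction T rule: finite_induct)
  case (insert t T)
  then obtain q where q: "p = (\<Prod>t\<in>T. [:- t, 1:]) ^ s * q" by (meson dvdE insertI2)
  have "poly ((\<Prod>t\<in>T. [:- t, 1:]) ^ s) t \<noteq> 0"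
    using insert.hyps by (simp add: poly_prod)
  then have "\<not> [:- t, 1:] dvd (\<Prod>t\<in>T. [:- t, 1:]) ^ s"
    by (simp only: poly_eq_0_iff_dvd simp_thms)
  moreover have "[:- t, 1:] ^ s dvd (\<Prod>t\<in>T. [:- t, 1:]) ^ s * q"
    using insert.prems[of t] q by simp
  ultimately have "[:- t, 1:] ^ s dvd q"
    by (rule prime_elem_power_dvd_cancel[OF prime_elem_linear])
  then have "[:- t, 1:] ^ s * (\<Prod>t\<in>T. [:- t, 1:]) ^ s dvd p"
    unfolding q by (subst mult.commute) (rule mult_dvd_mono[OF dvd_refl])
  then show ?case
    by (simp only: prod.insert[OF insert.hyps] power_mult_distrib)
qed simp

text \<open>Division with remainder by a form of degree \<open>m\<close> in \<open>x\<close> and \<open>z\<close> that is monic in \<open>z\<close> respects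
  the orders at both points at infinity.\<close>

lemma monic_form_division:
  fixes F f :: "'k::field poly3"
  assumes f: "f \<in> pair_power var_x var_z m" "coeff f m = 1" "\<And>k. m < k \<Longrightarrow> coeff f k = 0"
    and "F \<in> pair_power var_x var_z p" "F \<in> pair_power var_x var_y q"
  shows "\<exists>F0 F1. F = F0 + f * F1 \<and> (\<forall>k\<ge>m. coeff F0 k = 0) \<and>
    F0 \<in> pair_power var_x var_z p \<and> F0 \<in> pair_power var_x var_y q \<and>
    F1 \<in> pair_power var_x var_z (p - m) \<and> F1 \<in> pair_power var_x var_y q"
proof -
  have "?thesis" if "\<And>k. d \<le> k \<Longrightarrow> coeff F k = 0" for d
    using that assms(4,5)
  proof (induction d arbitrary: F)
    case 0
    then show ?case by (intro exI[of _ F] exI[of _ 0]) (simp add: pair_power.zero)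
  next
    case (Suc d)
    show ?case
    proof (cases "d < m")
      case True
      then have "\<forall>k\<ge>m. coeff F k = 0" using Suc.prems(1) by simp
      then show ?thesis using Suc.prems
        by (intro exI[of _ F] exI[of _ 0]) (simp add: pair_power.zero)
    next
      case False
      define T where "T = monom (coeff F d) (d - m)"
      have Tz: "T \<in> pair_power var_x var_z (p - m)"
        using Suc.prems(2) False unfolding pair_power_xz_iff T_def by auto
      have Ty: "T \<in> pair_power var_x var_y q"
        using Suc.prems(3) unfolding pair_power_xy_iff T_def by auto
      have "coeff (F - T * f) k = 0" if "d \<le> k" for k
        using that Suc.prems(1)[of k] f(2,3) False
        by (cases "k = d") (auto simp: T_def coeff_monom_mult)
      moreover have "T * f \<in> pair_power var_x var_z p"
        using pair_power_mult[OF Tz f(1)] by (rule pair_power_antimono) simp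
      then have "F - T * f \<in> pair_power var_x var_z p"
        by (intro pair_power_diff Suc.prems)
      moreover have "f * T \<in> pair_power var_x var_y q" by (rule pair_power_scale[OF Ty])
      then have "F - T * f \<in> pair_power var_x var_y q"
        by (intro pair_power_diff Suc.prems) (simp add: mult.commute)
      ultimately obtain F0 F1 where *: "F - T * f = F0 + f * F1" "\<forall>k\<ge>m. coeff F0 k = 0"
        "F0 \<in> pair_power var_x var_z p" "F0 \<in> pair_power var_x var_y q"
        "F1 \<in> pair_power var_x var_z (p - m)" "F1 \<in> pair_power var_x var_y q"
        using Suc.IH by meson
      have "F = F0 + f * (F1 + T)" using *(1) by (simp add: algebra_simps)
      then show ?thesis using * Tz Ty pair_power.add by blast
    qed
  qed
  from this[of "Suc (degree F)"] show ?thesis by (simp add: coeff_eq_0)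
qed

definition lines_z :: "'k::field set \<Rightarrow> 'k poly3" where
  "lines_z S = (\<Prod>\<alpha>\<in>S. (var_z - const3 \<alpha> * var_x))"

definition lines_y :: "'k::field set \<Rightarrow> 'k poly3" where
  "lines_y S = (\<Prod>\<beta>\<in>S. (var_y - const3 \<beta> * var_x))"

lemma linear_factor_z: "var_z - const3 \<alpha> * var_x = [:- [:[:0, \<alpha>:]:], 1:]"
  by (simp add: var_z_def const3_def var_x_def)

lemma linear_factor_y: "var_y - const3 \<beta> * var_x = [:[:- [:0, \<beta>:], 1:]:]"
  by (simp add: var_y_def const3_def var_x_def)

lemma const_poly_prod:
  fixes f :: "'i \<Rightarrow> 'a::comm_ring_1"
  shows "[:\<Prod>i\<in>I. f i:] = (\<Prod>i\<in>I. [:f i:])"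
  using type_hom.prod[OF type_hom_const_poly] .

lemma lines_y_eq: "lines_y S = [:\<Prod>\<beta>\<in>S. [:- [:0, \<beta>:], 1:]:]"
  unfolding lines_y_def linear_factor_y const_poly_prod ..

lemma lines_z_monic:
  assumes "finite S"
  shows "coeff (lines_z S) (card S) = 1" "card S < k \<Longrightarrow> coeff (lines_z S) k = 0"
proof -
  have "lead_coeff (lines_z S) = 1"
    unfolding lines_z_def linear_factor_z lead_coeff_prod by simp
  moreover have deg: "degree (lines_z S) = card S"
    unfolding lines_z_def linear_factor_z by (subst degree_prod_eq_sum_degree) simp_all
  ultimately show "coeff (lines_z S) (card S) = 1" by simp
  show "card S < k \<Longrightarrow> coeff (lines_z S) k = 0" using deg by (simp add: coeff_eq_0)
qed

lemma lines_z_order: "finite S \<Longrightarrow> lines_z S \<in> pair_power var_x var_z (card S)"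
proof (induction S rule: finite_induct)
  case (insert \<alpha> S)
  have "var_z - const3 \<alpha> * var_x \<in> pair_power var_x var_z 1"
    by (intro pair_power_diff pair_power_scale pair_power_generators)
  from pair_power_mult[OF this insert.IH] show ?case
    using insert.hyps by (simp add: lines_z_def)
qed (simp add: pair_power_0)

lemma lines_y_order: "finite S \<Longrightarrow> lines_y S \<in> pair_power var_x var_y (card S)"
proof (induction S rule: finite_induct)
  case (insert \<alpha> S)
  have "var_y - const3 \<alpha> * var_x \<in> pair_power var_x var_y 1"
    by (intro pair_power_diff pair_power_scale pair_power_generators)
  from pair_power_mult[OF this insert.IH] show ?case
    using insert.hyps by (simp add: lines_y_def)
qed (simp add: pair_power_0)

text \<open>The coefficient of \<open>x\<^sup>i y\<^sup>j\<^sup>+\<^sup>1\<close> in the product expresses the coefficient of \<open>x\<^sup>i y\<^sup>j\<close> in \<open>F\<close> through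
  that of \<open>x\<^sup>i\<^sup>-\<^sup>1 y\<^sup>j\<^sup>+\<^sup>1\<close>, which has the same total degree, so that induction on \<open>i\<close> applies.\<close>

lemma linear_y_order_cancel:
  fixes F :: "'k::field poly3"
  assumes "(var_y - const3 \<beta> * var_x) * F \<in> pair_power var_x var_y q"
  shows "F \<in> pair_power var_x var_y (q - 1)"
  unfolding pair_power_xy_iff
proof (intro allI impI)
  fix i j k assume "i + j < q - 1"
  then show "coeff (coeff (coeff F k) j) i = 0"
  proof (induction i arbitrary: j)
    case 0
    have "coeff (coeff (coeff ((var_y - const3 \<beta> * var_x) * F) k) (Suc j)) 0 = 0"
      using assms 0 unfolding pair_power_xy_iff by simp
    then show ?case unfolding linear_factor_y by simp
  next
    case (Suc i)
    have "coeff (coeff (coeff ((var_y - const3 \<beta> * var_x) * F) k) (Suc j)) (Suc i) = 0"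
      using assms Suc.prems unfolding pair_power_xy_iff by simp
    moreover have "coeff (coeff (coeff F k) (Suc j)) i = 0" using Suc by simp
    ultimately show ?case unfolding linear_factor_y by simp
  qed
qed

lemma lines_y_order_cancel:
  assumes "finite S" "lines_y S ^ s * F \<in> pair_power var_x var_y q"
  shows "F \<in> pair_power var_x var_y (q - card S * s)"
proof -
  have 1: "F \<in> pair_power var_x var_y (q - card S)" if "lines_y S * F \<in> pair_power var_x var_y q" for F q
    using assms(1) that
  proof (induction S arbitrary: q rule: finite_induct)
    case (insert \<beta> S)
    have "(var_y - const3 \<beta> * var_x) * (lines_y S * F) \<in> pair_power var_x var_y q"
      using insert.prems insert.hyps by (simp add: lines_y_def mult.assoc)
    from insert.IH[OF linear_y_order_cancel[OF this]] show ?case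
      using insert.hyps by simp
  qed (simp add: lines_y_def)
  show ?thesis using assms(2)
  proof (induction s arbitrary: q)
    case (Suc s)
    from Suc.prems have "lines_y S * (lines_y S ^ s * F) \<in> pair_power var_x var_y q"
      by (simp add: mult.assoc)
    from Suc.IH[OF 1[OF this]] show ?case by (simp add: diff_diff_left)
  qed simp
qed

lemma coord_x_not_dvd_monic:
  fixes q :: "'k::field poly poly"
  assumes "lead_coeff q = 1"
  shows "\<not> coord_x dvd q"
proof
  assume "coord_x dvd q"
  then have "[:0, 1:] dvd lead_coeff q" by (simp only: const_poly_dvd_iff)
  then show False using poly_eq_0_iff_dvd[of "1 :: 'k poly" 0] assms by simp
qed

lemma type_hom_poly: "type_hom (\<lambda>F. poly F t)"
  by unfold_locales simp_all

lemma pair_power_zero_right_dvd: "F \<in> pair_power u 0 s \<Longrightarrow> u ^ s dvd F"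
proof (induction F rule: pair_power.induct)
  case (gen k l h)
  then show ?case by (cases l) (auto simp: le_imp_power_dvd)
qed auto

text \<open>The values of \<open>F\<close> on the lines may be taken from different polynomials \<open>G\<close> of the required order.
  A polynomial of \<open>z\<close>-degree less than the number of lines \<open>z = \<alpha> x\<close> that vanishes to order \<open>s\<close>
  on the grid is divisible by the \<open>s\<close>-th power of the product of the lines \<open>y = \<beta> x\<close>: this holds after
  restriction to each line \<open>z = \<alpha> x\<close>, hence for all coefficients.\<close>

lemma lines_y_power_dvd:
  fixes F :: "'k::field poly3"
  assumes fin: "finite S" "finite T"
    and F: "\<And>k. card S \<le> k \<Longrightarrow> coeff F k = 0"
    and grid: "\<And>\<alpha> \<beta>. \<alpha> \<in> S \<Longrightarrow> \<beta> \<in> T \<Longrightarrow>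
      \<exists>G. poly F [:[:0, \<alpha>:]:] = poly G [:[:0, \<alpha>:]:] \<and>
        G \<in> pair_power (var_y - const3 \<beta> * var_x) (var_z - const3 \<alpha> * var_x) s"
  shows "lines_y T ^ s dvd F"
proof -
  define g where "g = (\<Prod>\<beta>\<in>T. [:- [:0, \<beta>:], 1 :: 'k poly:])"
  have lc: "lead_coeff (g ^ s) = 1"
    by (simp add: g_def lead_coeff_power lead_coeff_prod)
  have "g ^ s dvd coeff F k" for k
  proof -
    have "coeff F k \<in> {c. g ^ s dvd c}"
    proof (rule coeffs_in_ideal_if_values_in_ideal[where T = "(\<lambda>\<alpha>. [:[:0, \<alpha>:]:]) ` S"])
      fix u v c :: "'k poly poly"
      assume "u \<in> (\<lambda>\<alpha>. [:[:0, \<alpha>:]:]) ` S" "v \<in> (\<lambda>\<alpha>. [:[:0, \<alpha>:]:]) ` S" "u \<noteq> v"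
        and dvd: "(u - v) * c \<in> {c. g ^ s dvd c}"
      then obtain \<alpha> \<alpha>' where "u = [:[:0, \<alpha>:]:]" "v = [:[:0, \<alpha>':]:]" "\<alpha> \<noteq> \<alpha>'" by auto
      \<comment> \<open>The power of \<open>g\<close> is monic in \<open>y\<close>, hence prime to \<open>x\<close>, and differences of nodes are
        nonzero multiples of \<open>x\<close>.\<close>
      then have uv: "u - v = [:[:\<alpha> - \<alpha>':]:] * coord_x" by simp
      from dvd obtain e where e: "(u - v) * c = g ^ s * e" by auto
      have "coord_x ^ 1 dvd g ^ s * e" 
        unfolding e[symmetric] uv power_one_right by (intro dvd_mult2 dvd_triv_right)
      then have "coord_x dvd e"
        using prime_elem_power_dvd_cancel[OF prime_elem_coord_x coord_x_not_dvd_monic[OF lc], of 1 e]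
        by simp
      then obtain e' where "e = coord_x * e'" by (elim dvdE)
      then have "coord_x * ([:[:\<alpha> - \<alpha>':]:] * c) = coord_x * (g ^ s * e')"
        using e uv by (simp only: mult_ac)
      then have *: "[:[:\<alpha> - \<alpha>':]:] * c = g ^ s * e'"
        by (metis mult_cancel_left prime_elem_coord_x prime_elem_not_zeroI)
      have "c = [:[:1 / (\<alpha> - \<alpha>'):]:] * ([:[:\<alpha> - \<alpha>':]:] * c)"
        using \<open>\<alpha> \<noteq> \<alpha>'\<close> by (simp add: one_pCons[symmetric])
      also have "\<dots> = g ^ s * ([:[:1 / (\<alpha> - \<alpha>'):]:] * e')"
        unfolding * by (simp only: mult_ac)
      finally show "c \<in> {c. g ^ s dvd c}" by (metis dvd_triv_left mem_Collect_eq)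
    next
      fix t assume "t \<in> (\<lambda>\<alpha>. [:[:0, \<alpha>:]:]) ` S"
      then obtain \<alpha> where \<alpha>: "\<alpha> \<in> S" "t = [:[:0, \<alpha>:]:]" by blast
      have "[:- [:0, \<beta>:], 1:] ^ s dvd poly F t" if \<beta>: "\<beta> \<in> T" for \<beta>
      proof -
        obtain G where G: "poly F t = poly G t"
          "G \<in> pair_power (var_y - const3 \<beta> * var_x) (var_z - const3 \<alpha> * var_x) s"
          using grid[OF \<alpha>(1) \<beta>] \<alpha>(2) by blast
        have "poly G t \<in> pair_power (poly (var_y - const3 \<beta> * var_x) t) (poly (var_z - const3 \<alpha> * var_x) t) s"
          using pair_power_image[OF type_hom_poly G(2)] .
        moreover have "poly (var_y - const3 \<beta> * var_x) t = [:- [:0, \<beta>:], 1:]"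
          unfolding linear_factor_y by simp
        moreover have "poly (var_z - const3 \<alpha> * var_x) t = 0"
          unfolding linear_factor_z \<alpha>(2) by simp
        ultimately show ?thesis using pair_power_zero_right_dvd G(1) by metis
      qed
      then have "(\<Prod>t\<in>(\<lambda>\<beta>. [:0, \<beta>:]) ` T. [:- t, 1:]) ^ s dvd poly F t"
        using fin by (intro prod_linear_power_dvd) auto
      moreover have "(\<Prod>t\<in>(\<lambda>\<beta>. [:0, \<beta>:]) ` T. [:- t, 1:]) = g"
        unfolding g_def by (subst prod.reindex) (simp_all add: inj_on_def)
      ultimately show "poly F t \<in> {c. g ^ s dvd c}" by simp
    next
      fix k assume "card ((\<lambda>\<alpha>. [:[:0, \<alpha>:]:]) ` S) \<le> k"
      moreover have "card ((\<lambda>\<alpha>. [:[:0, \<alpha>:]:]) ` S) = card S"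
        by (intro card_image) (simp add: inj_on_def)
      ultimately show "coeff F k = 0" using F by simp
    qed (use fin in auto)
    then show ?thesis by simp
  qed
  then show ?thesis
    unfolding lines_y_eq g_def[symmetric] poly_const_pow const_poly_dvd_iff by blast
qed

text \<open>At the grid point with parameter \<open>\<alpha>\<close> only one factor of \<open>lines_z S\<close> vanishes, to first order.\<close>

lemma lines_z_grid_cancel:
  fixes F :: "'k::field poly3"
  assumes "finite S" "\<alpha> \<in> S"
    and "lines_z S * F \<in> pair_power (var_y - const3 \<beta> * var_x) (var_z - const3 \<alpha> * var_x) (Suc s)"
  shows "F \<in> pair_power (var_y - const3 \<beta> * var_x) (var_z - const3 \<alpha> * var_x) s"
proof -
  let ?u = "var_y - const3 \<beta> * var_x" and ?v = "var_z - const3 \<alpha> * var_x"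
  have split: "lines_z S = lines_z (S - {\<alpha>}) * ?v"
    using assms(1,2) by (simp add: lines_z_def prod.remove mult.commute)
  interpret h: type_hom "restrict_line (1, \<beta>, \<alpha>)" by (rule type_hom_restrict_line)
  have "restrict_line (1, \<beta>, \<alpha>) (lines_z (S - {\<alpha>})) \<noteq> 0"
    using assms(1) by (auto simp: lines_z_def h.prod h.hom_simps restrict_line_vars restrict_line_const3)
  then have "lines_z (S - {\<alpha>}) \<notin> pair_power ?u ?v 1"
    by (simp add: restrict_line_kernel_standard(3))
  then have "?v * F \<in> pair_power ?u ?v (Suc s)"
    using assms(3) coordinate_pair_primary[OF coordinate_pair_grid_point]
    by (simp only: split mult.assoc)
  then show ?thesis by (rule coordinate_pair_cancel[OF coordinate_pair_grid_point])
qed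

text \<open>The numbers \<open>p\<close>, \<open>q\<close> and \<open>s\<close> are lower bounds for the orders at \<open>(0:1:0)\<close>, at \<open>(0:0:1)\<close> and on the
  grid; \<open>m\<close> is the order of \<open>f\<close> at the first and \<open>n\<close> the order of \<open>g\<close> at the second of these points.\<close>

inductive_set monomial_span ::
    "'k::field poly3 \<Rightarrow> 'k poly3 \<Rightarrow> nat \<Rightarrow> nat \<Rightarrow> nat \<Rightarrow> nat \<Rightarrow> nat \<Rightarrow> 'k poly3 set"
  for f g m n p q s where
  zero: "0 \<in> monomial_span f g m n p q s"
| add: "F \<in> monomial_span f g m n p q s \<Longrightarrow> G \<in> monomial_span f g m n p q s \<Longrightarrow>
    F + G \<in> monomial_span f g m n p q s"
| monomial: "s \<le> a + b \<Longrightarrow> p \<le> h + j + m * a \<Longrightarrow> q \<le> h + i + n * b \<Longrightarrow>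
    const3 c * (var_x ^ h * var_y ^ i * var_z ^ j * f ^ a * g ^ b) \<in> monomial_span f g m n p q s"

lemma monomial_span_mult_f:
  assumes "F \<in> monomial_span f g m n (p - m) q s"
  shows "f * F \<in> monomial_span f g m n p q (Suc s)"
  using assms
proof (induction F rule: monomial_span.induct)
  case (monomial a b h j i c)
  have "const3 c * (var_x ^ h * var_y ^ i * var_z ^ j * f ^ Suc a * g ^ b)
      \<in> monomial_span f g m n p q (Suc s)"
    using monomial by (intro monomial_span.monomial) auto
  then show ?case by (simp add: mult_ac)
qed (auto simp: distrib_left intro: monomial_span.intros)

lemma monomial_span_mult_g_power:
  assumes "F \<in> pair_power var_x var_z p" "F \<in> pair_power var_x var_y (q - n * s)"
  shows "g ^ s * F \<in> monomial_span f g m n p q s"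
proof (rule poly3_monomial_induct[where F = F])
  fix i j k
  assume nz: "coeff (coeff (coeff F k) j) i \<noteq> 0"
  then have "p \<le> i + k" "q - n * s \<le> i + j"
    using assms unfolding pair_power_xz_iff pair_power_xy_iff by (meson not_le)+
  then have "const3 (coeff (coeff (coeff F k) j) i) *
      (var_x ^ i * var_y ^ j * var_z ^ k * f ^ 0 * g ^ s) \<in> monomial_span f g m n p q s"
    by (intro monomial_span.monomial) auto
  then show "g ^ s * (const3 (coeff (coeff (coeff F k) j) i) * var_x ^ i * var_y ^ j * var_z ^ k)
      \<in> monomial_span f g m n p q s"
    by (simp add: mult_ac)
qed (auto simp: distrib_left intro: monomial_span.intros)

text \<open>Divide by \<open>f = lines_z S\<close> and use induction on \<open>s\<close>. The remainder \<open>F0\<close> agrees with \<open>F\<close> on the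
  lines \<open>z = \<alpha> x\<close>, so it is \<open>g\<^sup>s Q\<close> with \<open>g = lines_y T\<close>, and the orders at the points at infinity
  say which monomials occur in \<open>Q\<close>. The quotient vanishes to order \<open>s - 1\<close> on the grid.\<close>

lemma in_monomial_span:
  fixes F :: "'k::field poly3"
  assumes fin: "finite S" "finite T"
    and "F \<in> pair_power var_x var_z p" "F \<in> pair_power var_x var_y q"
    and "\<And>\<alpha> \<beta>. \<alpha> \<in> S \<Longrightarrow> \<beta> \<in> T \<Longrightarrow>
      F \<in> pair_power (var_y - const3 \<beta> * var_x) (var_z - const3 \<alpha> * var_x) s"
  shows "F \<in> monomial_span (lines_z S) (lines_y T) (card S) (card T) p q s"
  using assms(3-)
proof (induction s arbitrary: p F)
  case 0
  then show ?case using monomial_span_mult_g_power[of F p q "card T" 0] by simp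
next
  case (Suc s)
  let ?f = "lines_z S" and ?g = "lines_y T" and ?m = "card S" and ?n = "card T"
  obtain F0 F1 where F: "F = F0 + ?f * F1" and deg: "\<forall>k\<ge>?m. coeff F0 k = 0"
    and F0: "F0 \<in> pair_power var_x var_z p" "F0 \<in> pair_power var_x var_y q"
    and F1: "F1 \<in> pair_power var_x var_z (p - ?m)" "F1 \<in> pair_power var_x var_y q"
    using monic_form_division[OF lines_z_order lines_z_monic Suc.prems(1,2)] fin by metis
  have "?g ^ Suc s dvd F0"
  proof (rule lines_y_power_dvd[OF fin])
    fix \<alpha> \<beta> assume "\<alpha> \<in> S" "\<beta> \<in> T"
    moreover have "poly ?f [:[:0, \<alpha>:]:] = 0"
      using \<open>\<alpha> \<in> S\<close> fin by (auto simp: lines_z_def linear_factor_z poly_prod)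
    then have "poly F0 [:[:0, \<alpha>:]:] = poly F [:[:0, \<alpha>:]:]" by (simp add: F)
    ultimately show "\<exists>G. poly F0 [:[:0, \<alpha>:]:] = poly G [:[:0, \<alpha>:]:] \<and>
        G \<in> pair_power (var_y - const3 \<beta> * var_x) (var_z - const3 \<alpha> * var_x) (Suc s)"
      using Suc.prems(3) by blast
  qed (use deg in simp)
  then obtain Q where Q: "F0 = ?g ^ Suc s * Q" by (elim dvdE)
  have "Q \<in> pair_power var_x var_z p"
    unfolding pair_power_xz_dvd_iff
  proof
    fix k
    define g where "g = (\<Prod>\<beta>\<in>T. [:- [:0, \<beta>:], 1 :: 'k poly:])"
    have "?g ^ Suc s = [:g ^ Suc s:]" by (simp only: lines_y_eq g_def[symmetric] poly_const_pow)
    then have "coeff F0 k = g ^ Suc s * coeff Q k" by (simp add: Q)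
    moreover have "coord_x ^ (p - k) dvd coeff F0 k" using F0(1) pair_power_xz_dvd_iff by blast
    moreover have "lead_coeff (g ^ Suc s) = 1"
      by (simp only: g_def lead_coeff_power lead_coeff_prod) simp
    ultimately show "coord_x ^ (p - k) dvd coeff Q k"
      using prime_elem_power_dvd_cancel[OF prime_elem_coord_x coord_x_not_dvd_monic] by metis
  qed
  moreover have "Q \<in> pair_power var_x var_y (q - ?n * Suc s)"
    using lines_y_order_cancel[OF fin(2)] F0(2) unfolding Q .
  ultimately have "F0 \<in> monomial_span ?f ?g ?m ?n p q (Suc s)"
    unfolding Q by (rule monomial_span_mult_g_power)
  moreover have "F1 \<in> monomial_span ?f ?g ?m ?n (p - ?m) q s"
  proof (rule Suc.IH[OF F1])
    fix \<alpha> \<beta> assume \<alpha>: "\<alpha> \<in> S" and \<beta>: "\<beta> \<in> T"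
    let ?u = "var_y - const3 \<beta> * var_x" and ?v = "var_z - const3 \<alpha> * var_x"
    have g: "?g = lines_y (T - {\<beta>}) * ?u"
      using fin \<beta> by (simp add: lines_y_def prod.remove mult.commute)
    have "?g \<in> pair_power ?u ?v 1"
      unfolding g by (rule pair_power_scale[OF pair_power_generators(1)])
    then have "?g ^ Suc s \<in> pair_power ?u ?v (Suc s)"
      using pair_power_power[of ?g ?u ?v 1 "Suc s"] by (simp only: mult_1_right)
    then have "F0 \<in> pair_power ?u ?v (Suc s)"
      unfolding Q by (subst mult.commute) (rule pair_power_scale)
    then have "F - F0 \<in> pair_power ?u ?v (Suc s)"
      by (intro pair_power_diff Suc.prems(3)[OF \<alpha> \<beta>])
    then have "?f * F1 \<in> pair_power ?u ?v (Suc s)" by (simp add: F)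
    then show "F1 \<in> pair_power ?u ?v s" by (rule lines_z_grid_cancel[OF fin(1) \<alpha>])
  qed
  then have "?f * F1 \<in> monomial_span ?f ?g ?m ?n p q (Suc s)" by (rule monomial_span_mult_f)
  ultimately show ?case unfolding F by (rule monomial_span.add)
qed

section \<open>Finite generation of monoids of exponent vectors\<close>

lemma nat_seq_monotone_subsequence:
  fixes t :: "nat \<Rightarrow> nat"
  shows "\<exists>h :: nat \<Rightarrow> nat. strict_mono h \<and> mono (\<lambda>n. t (h n))"
proof -
  obtain f :: "nat \<Rightarrow> nat" where f: "strict_mono f" "monoseq (\<lambda>n. t (f n))" using seq_monosub by blast
  consider "incseq (\<lambda>n. t (f n))" | "decseq (\<lambda>n. t (f n))" using f(2) monoseq_iff by blast
  then show ?thesis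
  proof cases
    case 1
    then show ?thesis using f(1) by blast
  next
    case 2
    \<comment> \<open>A decreasing sequence of natural numbers is constant from its minimum on.\<close>
    obtain k where k: "\<And>n. t (f k) \<le> t (f n)"
      using ex_has_least_nat[of "\<lambda>_. True" 0 "\<lambda>n. t (f n)"] by auto
    have "t (f (n + k)) = t (f k)" for n
      using decseqD[OF 2, of k "n + k"] k[of "n + k"] by simp
    moreover have "strict_mono (\<lambda>n. f (n + k))" using f(1) by (simp add: strict_mono_def)
    ultimately show ?thesis by (intro exI[of _ "\<lambda>n. f (n + k)"]) (simp add: mono_def)
  qed
qed

lemma common_monotone_subsequence:
  fixes \<phi>s :: "('a \<Rightarrow> nat) list"
  shows "\<exists>h :: nat \<Rightarrow> nat. strict_mono h \<and> (\<forall>\<phi>\<in>set \<phi>s. mono (\<lambda>n. \<phi> (s (h n))))"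
proof (induction \<phi>s)
  case Nil
  then show ?case by (auto intro: exI[of _ id] simp: strict_mono_def)
next
  case (Cons \<phi> \<phi>s)
  then obtain h :: "nat \<Rightarrow> nat" where h: "strict_mono h" "\<forall>\<phi>\<in>set \<phi>s. mono (\<lambda>n. \<phi> (s (h n)))" by blast
  obtain h' :: "nat \<Rightarrow> nat" where h': "strict_mono h'" "mono (\<lambda>n. \<phi> (s (h (h' n))))"
    using nat_seq_monotone_subsequence[of "\<lambda>n. \<phi> (s (h n))"] by blast
  have "mono (\<lambda>n. \<psi> (s (h (h' n))))" if "\<psi> \<in> set \<phi>s" for \<psi>
    using h(2) that strict_mono_mono[OF h'(1)] by (simp add: mono_def)
  moreover have "strict_mono (\<lambda>n. h (h' n))" using h(1) h'(1) by (simp add: strict_mono_def)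
  ultimately show ?case using h'(2) by (intro exI[of _ "\<lambda>n. h (h' n)"]) simp
qed

text \<open>A form of Gordan's lemma. The functions \<open>\<phi>\<close> embed \<open>M\<close> into a power of \<open>\<nat>\<close> in such a way that the
  componentwise order is divisibility in \<open>M\<close>. Infinitely many indecomposable elements would contain
  two comparable ones (Dickson's lemma), and the difference would decompose the larger one.\<close>

lemma exists_finite_generators:
  fixes M :: "'a::comm_monoid_add set" and \<phi>s :: "('a \<Rightarrow> nat) list"
  assumes additive: "\<And>\<phi> u v. \<phi> \<in> set \<phi>s \<Longrightarrow> u \<in> M \<Longrightarrow> v \<in> M \<Longrightarrow> \<phi> (u + v) = \<phi> u + \<phi> v"
    and diff: "\<And>u w. u \<in> M \<Longrightarrow> w \<in> M \<Longrightarrow> (\<And>\<phi>. \<phi> \<in> set \<phi>s \<Longrightarrow> \<phi> u \<le> \<phi> w) \<Longrightarrow> \<exists>v\<in>M. w = u + v"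
    and zero: "\<And>u. u \<in> M \<Longrightarrow> (\<And>\<phi>. \<phi> \<in> set \<phi>s \<Longrightarrow> \<phi> u = 0) \<Longrightarrow> u = 0"
  shows "\<exists>D. finite D \<and> D \<subseteq> M \<and> (\<forall>P. P 0 \<longrightarrow> (\<forall>u\<in>D. P u) \<longrightarrow>
    (\<forall>u v. P u \<longrightarrow> P v \<longrightarrow> P (u + v)) \<longrightarrow> (\<forall>w\<in>M. P w))"
proof -
  define D where "D = {w \<in> M. w \<noteq> 0 \<and> \<not> (\<exists>u\<in>M. \<exists>v\<in>M. u \<noteq> 0 \<and> v \<noteq> 0 \<and> w = u + v)}"
  have "finite D"
  proof (rule ccontr)
    assume "infinite D"
    then obtain s :: "nat \<Rightarrow> 'a" where s: "inj s" "range s \<subseteq> D"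
      using infinite_countable_subset by blast
    obtain h :: "nat \<Rightarrow> nat" where h: "strict_mono h" "\<And>\<phi>. \<phi> \<in> set \<phi>s \<Longrightarrow> mono (\<lambda>n. \<phi> (s (h n)))"
      using common_monotone_subsequence[of \<phi>s s] by blast
    have D: "s k \<in> D" for k using s(2) by blast
    have "\<phi> (s (h 0)) \<le> \<phi> (s (h 1))" if "\<phi> \<in> set \<phi>s" for \<phi>
      using h(2)[OF that] by (simp add: mono_def)
    then obtain v where v: "v \<in> M" "s (h 1) = s (h 0) + v"
      using diff[of "s (h 0)" "s (h 1)"] D by (auto simp: D_def)
    have "s (h 1) \<noteq> s (h 0)"
      using s(1) h(1) by (metis injD strict_mono_eq zero_neq_one)
    then have "v \<noteq> 0" using v(2) by auto
    then show False using v D[of "h 0"] D[of "h 1"] unfolding D_def by blast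
  qed
  moreover have "D \<subseteq> M" by (auto simp: D_def)
  moreover have gen: "P w"
    if P: "P 0" "\<And>u. u \<in> D \<Longrightarrow> P u" "\<And>u v. P u \<Longrightarrow> P v \<Longrightarrow> P (u + v)" and "w \<in> M" for P w
    using \<open>w \<in> M\<close>
  proof (induction "\<Sum>\<phi>\<leftarrow>\<phi>s. \<phi> w" arbitrary: w rule: less_induct)
    case less
    show ?case
    proof (cases "w = 0 \<or> w \<in> D")
      case True
      then show ?thesis using P by auto
    next
      case False
      then obtain u v where uv: "u \<in> M" "v \<in> M" "u \<noteq> 0" "v \<noteq> 0" "w = u + v"
        using less.prems unfolding D_def by blast
      have size: "(\<Sum>\<phi>\<leftarrow>\<phi>s. \<phi> w) = (\<Sum>\<phi>\<leftarrow>\<phi>s. \<phi> u) + (\<Sum>\<phi>\<leftarrow>\<phi>s. \<phi> v)"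
        unfolding sum_list_addf[symmetric] using additive uv
        by (intro arg_cong[of _ _ sum_list] map_cong) auto
      have "0 < (\<Sum>\<phi>\<leftarrow>\<phi>s. \<phi> u)" if "u \<in> M" "u \<noteq> 0" for u
        using zero[OF that(1)] that(2) by (force simp: sum_list_eq_0_iff intro!: Nat.gr0I)
      then have "P u" "P v" using less.hyps uv size by auto
      then show ?thesis unfolding uv(5) by (rule P(3))
    qed
  qed
  ultimately show ?thesis
  proof (intro exI[of _ D] conjI allI impI ballI)
    fix P w
    assume "P 0" "\<forall>u\<in>D. P u" "\<forall>u v. P u \<longrightarrow> P v \<longrightarrow> P (u + v)" "w \<in> M"
    then show "P w" using gen[of P w] by simp
  qed
qed

text \<open>Exponent vectors \<open>(h, i, j, a, b, r)\<close> of the monomials \<open>x\<^sup>h y\<^sup>i z\<^sup>j f\<^sup>a g\<^sup>b t\<^sup>r\<close> of the symbolic Rees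
  ring; the three inequalities bound \<open>r\<close> by the order on the grid and at the two points at infinity.\<close>

definition admissible_exponents :: "nat \<Rightarrow> nat \<Rightarrow> (nat \<times> nat \<times> nat \<times> nat \<times> nat \<times> nat) set" where
  "admissible_exponents m n =
     {(h, i, j, a, b, r). r \<le> a + b \<and> r \<le> h + j + m * a \<and> r \<le> h + i + n * b}"

lemma admissible_exponents_finite_generators:
  obtains D where "finite D" "D \<subseteq> admissible_exponents m n"
    "\<And>P w. P (0, 0, 0, 0, 0, 0) \<Longrightarrow> (\<And>u. u \<in> D \<Longrightarrow> P u) \<Longrightarrow>
      (\<And>h i j a b r h' i' j' a' b' r'. P (h, i, j, a, b, r) \<Longrightarrow> P (h', i', j', a', b', r') \<Longrightarrow>
        P (h + h', i + i', j + j', a + a', b + b', r + r')) \<Longrightarrow>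
      w \<in> admissible_exponents m n \<Longrightarrow> P w"
proof -
  define \<phi>s :: "(nat \<times> nat \<times> nat \<times> nat \<times> nat \<times> nat \<Rightarrow> nat) list" where
    "\<phi>s = [\<lambda>(h, i, j, a, b, r). h, \<lambda>(h, i, j, a, b, r). i, \<lambda>(h, i, j, a, b, r). j,
      \<lambda>(h, i, j, a, b, r). a, \<lambda>(h, i, j, a, b, r). b, \<lambda>(h, i, j, a, b, r). r,
      \<lambda>(h, i, j, a, b, r). a + b - r, \<lambda>(h, i, j, a, b, r). h + j + m * a - r,
      \<lambda>(h, i, j, a, b, r). h + i + n * b - r]"
  have "\<exists>D. finite D \<and> D \<subseteq> admissible_exponents m n \<and>
    (\<forall>P. P 0 \<longrightarrow> (\<forall>u\<in>D. P u) \<longrightarrow> (\<forall>u v. P u \<longrightarrow> P v \<longrightarrow> P (u + v)) \<longrightarrow>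
      (\<forall>w\<in>admissible_exponents m n. P w))"
  proof (rule exists_finite_generators[of \<phi>s "admissible_exponents m n"])
    fix \<phi> u v
    assume "\<phi> \<in> set \<phi>s" "u \<in> admissible_exponents m n" "v \<in> admissible_exponents m n"
    then show "\<phi> (u + v) = \<phi> u + \<phi> v"
      by (cases u; cases v) (auto simp: \<phi>s_def admissible_exponents_def distrib_left)
  next
    fix u w
    assume uw: "u \<in> admissible_exponents m n" "w \<in> admissible_exponents m n"
      and le: "\<And>\<phi>. \<phi> \<in> set \<phi>s \<Longrightarrow> \<phi> u \<le> \<phi> w"
    obtain h i j a b r where u: "u = (h, i, j, a, b, r)" by (cases u)
    obtain h' i' j' a' b' r' where w: "w = (h', i', j', a', b', r')" by (cases w)
    have ball: "\<forall>\<phi>\<in>set \<phi>s. \<phi> u \<le> \<phi> w" using le by blast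
    have c: "h \<le> h'" "i \<le> i'" "j \<le> j'" "a \<le> a'" "b \<le> b'" "r \<le> r'" "a + b - r \<le> a' + b' - r'"
      "h + j + m * a - r \<le> h' + j' + m * a' - r'" "h + i + n * b - r \<le> h' + i' + n * b' - r'"
      using ball unfolding \<phi>s_def u w by simp_all
    have e: "r \<le> a + b" "r' \<le> a' + b'" "r \<le> h + j + m * a" "r' \<le> h' + j' + m * a'"
      "r \<le> h + i + n * b" "r' \<le> h' + i' + n * b'"
      using uw unfolding u w admissible_exponents_def by simp_all
    have ma: "m * (a' - a) = m * a' - m * a" "m * a \<le> m * a'"
      and nb: "n * (b' - b) = n * b' - n * b" "n * b \<le> n * b'"
      using c(4,5) by (simp_all add: diff_mult_distrib2)
    have "r' - r \<le> (a' - a) + (b' - b)" using c(4-7) e(1,2) by linarith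
    moreover have "r' - r \<le> (h' - h) + (j' - j) + m * (a' - a)"
      unfolding ma(1) using c(1,3,6,8) e(3,4) ma(2) by linarith
    moreover have "r' - r \<le> (h' - h) + (i' - i) + n * (b' - b)"
      unfolding nb(1) using c(1,2,6,9) e(5,6) nb(2) by linarith
    ultimately have "(h' - h, i' - i, j' - j, a' - a, b' - b, r' - r) \<in> admissible_exponents m n"
      unfolding admissible_exponents_def by simp
    then show "\<exists>v\<in>admissible_exponents m n. w = u + v"
      using c unfolding u w by (intro bexI) auto
  next
    fix u
    assume "\<And>\<phi>. \<phi> \<in> set \<phi>s \<Longrightarrow> \<phi> u = 0"
    then have "\<forall>\<phi>\<in>set \<phi>s. \<phi> u = 0" by blast
    then show "u = 0" unfolding \<phi>s_def by (cases u) (simp add: zero_prod_def)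
  qed
  then obtain D where D: "finite D" "D \<subseteq> admissible_exponents m n"
    "\<forall>P. P 0 \<longrightarrow> (\<forall>u\<in>D. P u) \<longrightarrow> (\<forall>u v. P u \<longrightarrow> P v \<longrightarrow> P (u + v)) \<longrightarrow>
      (\<forall>w\<in>admissible_exponents m n. P w)" by blast
  show ?thesis
  proof (rule that[OF D(1,2)])
    fix P w
    assume "P (0, 0, 0, 0, 0, 0)" "\<And>u. u \<in> D \<Longrightarrow> P u" "w \<in> admissible_exponents m n"
      and add: "\<And>h i j a b r h' i' j' a' b' r'. P (h, i, j, a, b, r) \<Longrightarrow> P (h', i', j', a', b', r') \<Longrightarrow>
        P (h + h', i + i', j + j', a + a', b + b', r + r')"
    then show "P w"
      using D(3)[rule_format, of P w] by (auto simp: zero_prod_def)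
  qed
qed

section \<open>Symbolic powers of the ideal of a finite set of points\<close>

lemma primeideal_type_iff:
  "primeideal p (ring_of_type_algebra :: 'a::comm_ring_1 ring) \<longleftrightarrow>
     ideal p (ring_of_type_algebra :: 'a ring) \<and> 1 \<notin> p \<and> (\<forall>a b. a * b \<in> p \<longrightarrow> a \<in> p \<or> b \<in> p)"
proof
  assume "primeideal p (ring_of_type_algebra :: 'a ring)"
  then interpret primeideal p "ring_of_type_algebra :: 'a ring" .
  have 1: "ideal p (ring_of_type_algebra :: 'a ring)" by (rule is_ideal)
  have "1 \<notin> p"
  proof
    assume "1 \<in> p"
    then have "r * 1 \<in> p" for r using 1 unfolding ideal_type_iff by blast
    then have "p = UNIV" by auto
    then show False using I_notcarr by (simp add: ring_of_type_algebra_def)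
  qed
  moreover have "\<forall>a b. a * b \<in> p \<longrightarrow> a \<in> p \<or> b \<in> p"
    using I_prime unfolding ring_of_type_algebra_def by simp
  ultimately show "ideal p (ring_of_type_algebra :: 'a ring) \<and> 1 \<notin> p \<and> (\<forall>a b. a * b \<in> p \<longrightarrow> a \<in> p \<or> b \<in> p)"
    using 1 by blast
next
  assume p: "ideal p (ring_of_type_algebra :: 'a ring) \<and> 1 \<notin> p \<and> (\<forall>a b. a * b \<in> p \<longrightarrow> a \<in> p \<or> b \<in> p)"
  show "primeideal p (ring_of_type_algebra :: 'a ring)"
  proof (rule primeidealI)
    show "cring (ring_of_type_algebra :: 'a ring)" by (rule cring_from_type_algebra)
  qed (use p in \<open>auto simp: ring_of_type_algebra_def\<close>)
qed

text \<open>The fractions with numerator in a \<open>p\<close>-primary ideal \<open>I\<close> form an ideal of the localization,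
  and clearing denominators shows that no new elements of the ring lie in it.\<close>

lemma extend_local_contract:
  fixes p I :: "'a::idom set"
  assumes p: "primeideal p ring_of_type_algebra"
    and I: "ideal I ring_of_type_algebra"
    and primary: "\<And>a s. s \<notin> p \<Longrightarrow> s * a \<in> I \<Longrightarrow> a \<in> I"
  shows "{a. Fract a 1 \<in> extend_local p I} = I"
proof -
  have p1: "1 \<notin> p" and p_mult: "\<And>s t. s \<notin> p \<Longrightarrow> t \<notin> p \<Longrightarrow> s * t \<notin> p" and p0: "0 \<in> p"
    using p unfolding primeideal_type_iff ideal_type_iff by blast+
  have I0: "0 \<in> I" and I_add: "\<And>a b. a \<in> I \<Longrightarrow> b \<in> I \<Longrightarrow> a + b \<in> I"
    and I_mult: "\<And>a r. a \<in> I \<Longrightarrow> r * a \<in> I"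
    using I unfolding ideal_type_iff by blast+
  have nz: "s \<noteq> 0" if "s \<notin> p" for s using that p0 by blast
  define L where "L = {Fract a s | a s. s \<notin> p}"
  have L_neg: "- h \<in> L" if h: "h \<in> L" for h
  proof -
    obtain a s where *: "h = Fract a s" "s \<notin> p" using h unfolding L_def by blast
    have "- h = Fract (- a) s" using * by simp
    then show ?thesis using *(2) unfolding L_def by blast
  qed
  interpret F: ring "ring_of_type_algebra :: 'a fract ring" by (rule ring_from_type_algebra)
  have L: "subring L (ring_of_type_algebra :: 'a fract ring)"
  proof (rule F.subringI)
    show "\<one>\<^bsub>ring_of_type_algebra\<^esub> \<in> L"
      using p1 by (auto simp: L_def ring_of_type_algebra_def One_fract_def)
    show "\<ominus>\<^bsub>ring_of_type_algebra\<^esub> h \<in> L" if "h \<in> L" for h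
      unfolding a_inv_type by (rule L_neg[OF that])
    fix h k assume "h \<in> L" "k \<in> L"
    then obtain a s b t where *: "h = Fract a s" "s \<notin> p" "k = Fract b t" "t \<notin> p"
      by (auto simp: L_def)
    show "h \<otimes>\<^bsub>ring_of_type_algebra\<^esub> k \<in> L"
      using p_mult[OF *(2,4)] unfolding L_def ring_of_type_algebra_def *(1,3) by auto
    show "h \<oplus>\<^bsub>ring_of_type_algebra\<^esub> k \<in> L"
      using p_mult[OF *(2,4)] nz *(2,4) unfolding L_def ring_of_type_algebra_def *(1,3) by auto
  qed (simp add: ring_of_type_algebra_def)
  have local: "local_ring p = ring_of_type_algebra\<lparr>carrier := L\<rparr>"
    by (simp add: local_ring_def L_def)
  interpret L: ring "local_ring p"
    unfolding local by (rule F.subring_is_ring[OF L])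
  have ops: "carrier (local_ring p) = L" "\<And>a b. a \<oplus>\<^bsub>local_ring p\<^esub> b = a + b"
    "\<And>a b. a \<otimes>\<^bsub>local_ring p\<^esub> b = a * b" "\<zero>\<^bsub>local_ring p\<^esub> = 0"
    unfolding local by (simp_all add: ring_of_type_algebra_def)
  define J where "J = {Fract a s | a s. a \<in> I \<and> s \<notin> p}"
  have JL: "J \<subseteq> L" by (auto simp: J_def L_def)
  have J_mult: "h * k \<in> J" "k * h \<in> J" if "h \<in> L" "k \<in> J" for h k
  proof -
    obtain a s b t where *: "h = Fract a s" "s \<notin> p" "k = Fract b t" "b \<in> I" "t \<notin> p"
      using \<open>h \<in> L\<close> \<open>k \<in> J\<close> unfolding L_def J_def by blast
    have "h * k = Fract (a * b) (s * t)" using * by simp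
    then show "h * k \<in> J" using I_mult[OF *(4)] p_mult[OF *(2,5)] unfolding J_def by blast
    then show "k * h \<in> J" by (simp add: mult.commute)
  qed
  have "ideal J (local_ring p)"
  proof (rule idealI)
    show "ring (local_ring p)" by (rule L.ring_axioms)
    show "subgroup J (add_monoid (local_ring p))"
    proof (rule L.add.subgroupI)
      show "J \<subseteq> carrier (local_ring p)" using JL by (simp add: ops)
      show "J \<noteq> {}" using I0 p1 unfolding J_def by blast
      fix h assume h: "h \<in> J"
      have "\<ominus>\<^bsub>local_ring p\<^esub> h = - h"
        using h JL L_neg by (intro L.minus_equality) (auto simp: ops)
      moreover have "- h \<in> J"
      proof -
        obtain a s where *: "h = Fract a s" "a \<in> I" "s \<notin> p" using h unfolding J_def by blast
        have "- h = Fract (- 1 * a) s" using * by simp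
        then show ?thesis using I_mult[OF *(2)] *(3) unfolding J_def by blast
      qed
      ultimately show "\<ominus>\<^bsub>local_ring p\<^esub> h \<in> J" by simp
      fix k assume k: "k \<in> J"
      obtain a s where h': "h = Fract a s" "a \<in> I" "s \<notin> p" using h unfolding J_def by blast
      obtain b t where k': "k = Fract b t" "b \<in> I" "t \<notin> p" using k unfolding J_def by blast
      have "h + k = Fract (t * a + s * b) (s * t)" using h' k' nz by (simp add: mult.commute)
      moreover have "t * a + s * b \<in> I" using h'(2) k'(2) I_add I_mult by blast
      ultimately show "h \<oplus>\<^bsub>local_ring p\<^esub> k \<in> J"
        unfolding ops using p_mult[OF h'(3) k'(3)] unfolding J_def by blast
    qed
  qed (simp_all add: ops J_mult)
  moreover have "(\<lambda>a. Fract a 1) ` I \<subseteq> J" using p1 unfolding J_def by blast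
  ultimately have "extend_local p I \<subseteq> J"
    unfolding extend_local_def genideal_def by blast
  moreover have "a \<in> I" if a: "Fract a 1 \<in> J" for a
  proof -
    obtain b s where *: "Fract a 1 = Fract b s" "b \<in> I" "s \<notin> p" using a unfolding J_def by blast
    then have "s * a = b" using nz by (simp add: eq_fract mult.commute)
    then show ?thesis using primary[OF *(3), of a] *(2) by simp
  qed
  moreover have "Fract a 1 \<in> extend_local p I" if "a \<in> I" for a
    using that unfolding extend_local_def genideal_def by blast
  ultimately show ?thesis by blast
qed

lemma primeideal_contains_component:
  assumes "primeideal p (ring_of_type_algebra :: 'a::comm_ring_1 ring)" "finite H"
    and "\<And>P. P \<in> H \<Longrightarrow> ideal (J P) ring_of_type_algebra"
    and "(\<Inter>P\<in>H. J P) \<subseteq> p"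
  shows "\<exists>P\<in>H. J P \<subseteq> p"
proof (rule ccontr)
  assume "\<not> (\<exists>P\<in>H. J P \<subseteq> p)"
  then have "\<forall>P\<in>H. \<exists>a. a \<in> J P \<and> a \<notin> p" by blast
  then obtain a where a: "\<And>P. P \<in> H \<Longrightarrow> a P \<in> J P" "\<And>P. P \<in> H \<Longrightarrow> a P \<notin> p" by metis
  have "(\<Prod>P\<in>H. a P) \<notin> p"
    using assms(2) a(2)
  proof (induction H rule: finite_induct)
    case empty
    then show ?case using assms(1) by (simp add: primeideal_type_iff)
  next
    case (insert P H)
    then show ?case using assms(1) by (auto simp: primeideal_type_iff)
  qed
  moreover have "(\<Prod>P\<in>H. a P) \<in> J Q" if "Q \<in> H" for Q
    using assms(3)[OF that] a(1)[OF that] that assms(2)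
    by (simp add: prod.remove ideal_type_iff mult.commute)
  ultimately show False using assms(4) by blast
qed

lemma point_ideal_coordinate_pair:
  fixes P :: "'k::field proj_plane"
  obtains u v where "coordinate_pair u v" "point_ideal P = pair_power u v 1"
proof -
  obtain a where a: "a \<noteq> (0, 0, 0)" "P = abs_proj_plane a" by (rule proj_plane_cases)
  obtain a1 a2 a3 where a_eq: "a = (a1, a2, a3)" by (cases a)
  have "\<exists>b. cross3 a b \<noteq> (0, 0, 0)"
  proof (cases "a1 = 0 \<and> a2 = 0")
    case True
    then show ?thesis using a(1) by (intro exI[of _ "(1, 0, 0)"]) (auto simp: a_eq cross3_def)
  next
    case False
    then show ?thesis by (intro exI[of _ "(0, 0, 1)"]) (auto simp: a_eq cross3_def)
  qed
  then obtain b where "cross3 a b \<noteq> (0, 0, 0)" by blast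
  then obtain \<xi> \<eta> \<zeta> where dual: "dot3 \<xi> a = 0" "dot3 \<eta> a = 1" "dot3 \<zeta> a = 0"
    and bij: "bij (endo3 (linear_form \<xi>) (linear_form \<eta>) (linear_form \<zeta>))"
    by (rule exists_dual_basis) blast
  let ?\<sigma> = "endo3 (linear_form \<xi>) (linear_form \<eta>) (linear_form \<zeta>)"
  have "{F. restrict_line a F = 0} = pair_power (?\<sigma> var_x) (?\<sigma> var_z) 1"
    by (rule point_kernel_transport[OF type_hom_endo3 bij restrict_line_endo3])
      (simp add: dual restrict_line_kernel_standard)
  moreover have "coordinate_pair (?\<sigma> var_x) (?\<sigma> var_z)"
    unfolding coordinate_pair_def using type_hom_endo3 bij by blast
  ultimately show ?thesis using that a by (simp add: point_ideal_abs)
qed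

lemma primeideal_point_ideal: "primeideal (point_ideal P) ring_of_type_algebra"
proof -
  obtain v where v: "v \<noteq> (0, 0, 0)" "P = abs_proj_plane v" by (rule proj_plane_cases)
  interpret h: type_hom "restrict_line v" by (rule type_hom_restrict_line)
  show ?thesis
    by (simp add: v point_ideal_abs primeideal_type_iff ideal_type_iff h.hom_simps)
qed

lemma point_ideal_subset_imp_eq:
  fixes P Q :: "'k::field proj_plane"
  assumes "point_ideal P \<subseteq> point_ideal Q"
  shows "P = Q"
proof -
  obtain v where v: "v \<noteq> (0, 0, 0)" "P = abs_proj_plane v" by (rule proj_plane_cases)
  obtain w where w: "w \<noteq> (0, 0, 0)" "Q = abs_proj_plane w" by (rule proj_plane_cases)
  obtain a b c where v_eq: "v = (a, b, c)" by (cases v)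
  obtain a' b' c' where w_eq: "w = (a', b', c')" by (cases w)
  have "minors v \<subseteq> point_ideal P"
    using ideal_gen_superset[of "minors v"] v by (simp add: point_ideal_abs ideal_gen_minors)
  then have "minors v \<subseteq> {F. restrict_line w F = 0}"
    using assms w by (simp add: point_ideal_abs)
  then have "cross3 v w = (0, 0, 0)"
    by (auto simp: minors_def cross3_def v_eq w_eq restrict_line_vars restrict_line_const3
        type_hom.hom_simps[OF type_hom_restrict_line] mult.commute)
  then have "proj_rel v w" using cross3_nonzero v(1) w(1) by blast
  then show ?thesis unfolding v(2) w(2) by (rule abs_proj_plane_eq)
qed

lemma minimal_primes_points_ideal:
  assumes "finite H"
  shows "minimal_primes (points_ideal H) = point_ideal ` H"
proof -
  have ideal: "ideal (point_ideal P) ring_of_type_algebra" for P :: "'a proj_plane"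
    using primeideal_point_ideal primeideal_type_iff by blast
  have component: "\<exists>P\<in>H. point_ideal P \<subseteq> q"
    if "primeideal q ring_of_type_algebra" "points_ideal H \<subseteq> q" for q
    using primeideal_contains_component[OF that(1) assms, of point_ideal] that(2) ideal
    by (simp add: points_ideal_def)
  have lower: "points_ideal H \<subseteq> point_ideal P" if "P \<in> H" for P
    using that by (auto simp: points_ideal_def)
  show ?thesis
  proof (intro subset_antisym subsetI)
    fix p assume "p \<in> minimal_primes (points_ideal H)"
    then have p: "primeideal p ring_of_type_algebra" "points_ideal H \<subseteq> p"
      and min: "\<And>q. primeideal q ring_of_type_algebra \<Longrightarrow> points_ideal H \<subseteq> q \<Longrightarrow> q \<subseteq> p \<Longrightarrow> q = p"
      by (auto simp: minimal_primes_def)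
    obtain P where P: "P \<in> H" "point_ideal P \<subseteq> p" using component[OF p] by blast
    then show "p \<in> point_ideal ` H" using min[OF primeideal_point_ideal lower] by blast
  next
    fix p assume "p \<in> point_ideal ` H"
    then obtain P where P: "P \<in> H" "p = point_ideal P" by blast
    have "q = p" if q: "primeideal q ring_of_type_algebra" "points_ideal H \<subseteq> q" "q \<subseteq> p" for q
    proof -
      obtain Q where Q: "Q \<in> H" "point_ideal Q \<subseteq> q" using component[OF q(1,2)] by blast
      then have "Q = P" using point_ideal_subset_imp_eq[of Q P] q(3) P(2) by blast
      then show ?thesis using Q q(3) P(2) by blast
    qed
    then show "p \<in> minimal_primes (points_ideal H)"
      using P lower primeideal_point_ideal by (auto simp: minimal_primes_def)
  qed
qed

text \<open>The minimal primes are the ideals of the points, because these are pairwise incomparable, and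
  the powers of each of them are primary, because it is generated by two coordinates.\<close>

lemma symbolic_power_points_ideal:
  assumes "finite H"
  shows "symbolic_power (points_ideal H) r = (\<Inter>P\<in>H. ideal_pow (point_ideal P) r)"
proof -
  have "{a. Fract a 1 \<in> extend_local (point_ideal P) (ideal_pow (point_ideal P) r)} =
      ideal_pow (point_ideal P) r" for P :: "'a proj_plane"
  proof -
    obtain u v where uv: "coordinate_pair u v" "point_ideal P = pair_power u v 1"
      by (rule point_ideal_coordinate_pair)
    show ?thesis
    proof (rule extend_local_contract[OF primeideal_point_ideal])
      show "ideal (ideal_pow (point_ideal P) r) ring_of_type_algebra"
        unfolding uv(2) ideal_pow_pair_power by (rule ideal_pair_power)
      show "a \<in> ideal_pow (point_ideal P) r"
        if "s \<notin> point_ideal P" "s * a \<in> ideal_pow (point_ideal P) r" for a s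
        using that coordinate_pair_primary[OF uv(1)] unfolding uv(2) ideal_pow_pair_power by blast
    qed
  qed
  then show ?thesis
    by (simp add: symbolic_power_def minimal_primes_points_ideal[OF assms])
qed

section \<open>Binary forms\<close>

text \<open>The homomorphism \<open>F(x,y,z) \<mapsto> F(s x, s y, s z)\<close>. It detects homogeneity, and taking coefficients
  of \<open>s\<^sup>m\<close> extracts homogeneous components.\<close>

definition scale_vars :: "'k::comm_ring_1 poly3 \<Rightarrow> 'k poly3 poly" where
  "scale_vars = subst3 (\<lambda>e. [:const3 e:]) [:0, var_x:] [:0, var_y:] [:0, var_z:]"

lemma type_hom_const_const3: "type_hom (\<lambda>e. [:const3 e:])"
  by unfold_locales (simp_all add: const3_simps one_pCons)

lemmas type_hom_scale_vars =
  type_hom_subst3[OF type_hom_const_const3, of "[:0, var_x:]" "[:0, var_y:]" "[:0, var_z:]",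
    folded scale_vars_def]
lemmas scale_vars_simps =
  subst3_simps[OF type_hom_const_const3, of "[:0, var_x:]" "[:0, var_y:]" "[:0, var_z:]",
    folded scale_vars_def] type_hom.hom_simps[OF type_hom_scale_vars]

lemma linear_monomial_power: "[:0, c:] ^ k = monom (c ^ k) k"
  for c :: "'a::comm_ring_1"
proof (induction k)
  case (Suc k)
  have "[:0, c:] = monom c 1" by (simp add: monom_altdef)
  then show ?case using Suc by (simp only: power_Suc mult_monom) simp
qed simp

lemma scale_vars_homogeneous:
  assumes "homogeneous f m"
  shows "scale_vars f = monom f m"
proof (induction rule: poly3_monomial_induct[where F = f])
  case (monomial i j k)
  then have "i + j + k = m" using assms by (auto simp: homogeneous_def)
  then show ?case
    by (simp add: scale_vars_simps linear_monomial_power mult_monom smult_monom add.assoc mult.assoc)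
qed (simp_all add: scale_vars_simps add_monom)

lemma scale_vars_linear_form: "scale_vars (linear_form l) = [:0, linear_form l:]"
  by (cases l) (simp add: linear_form_def scale_vars_simps)

lemma coeff_0_scale_vars: "\<exists>c. coeff (scale_vars F) 0 = const3 c"
proof (induction F rule: poly3_induct)
  case (const a)
  then show ?case by (intro exI[of _ a]) (simp add: scale_vars_simps)
next
  case (add F G)
  then show ?case by (auto simp: scale_vars_simps const3_simps[symmetric])
next
  case (mult F G)
  then show ?case by (auto simp: scale_vars_simps coeff_mult const3_simps[symmetric])
qed (auto simp: scale_vars_simps intro!: exI[of _ 0] simp: const3_simps)

text \<open>Write \<open>f = \<Sum> h\<^sub>k U\<^sup>k W\<^sup>l\<close> with \<open>k + l \<ge> m\<close>, scale the variables by \<open>s\<close> and compare coefficients of \<open>s\<^sup>m\<close>: only the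
  constant terms of the \<open>h\<^sub>k\<close> with \<open>k + l = m\<close> survive.\<close>

lemma homogeneous_pair_power_binary_form:
  assumes "homogeneous f m" "f \<in> pair_power (linear_form \<xi>) (linear_form \<zeta>) m"
  shows "\<exists>c. f = (\<Sum>k\<le>m. const3 (c k) * linear_form \<xi> ^ k * linear_form \<zeta> ^ (m - k))"
proof -
  let ?U = "linear_form \<xi>" and ?W = "linear_form \<zeta>"
  have "\<exists>c. coeff (scale_vars F) m = (\<Sum>k\<le>m. const3 (c k) * ?U ^ k * ?W ^ (m - k))"
    if "F \<in> pair_power ?U ?W m" for F
    using that
  proof (induction F rule: pair_power.induct)
    case zero
    then show ?case by (intro exI[of _ "\<lambda>_. 0"]) (simp add: scale_vars_simps const3_simps)
  next
    case (add F G)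
    then obtain c d where "coeff (scale_vars F) m = (\<Sum>k\<le>m. const3 (c k) * ?U ^ k * ?W ^ (m - k))"
      "coeff (scale_vars G) m = (\<Sum>k\<le>m. const3 (d k) * ?U ^ k * ?W ^ (m - k))" by blast
    then show ?case
      by (intro exI[of _ "\<lambda>k. c k + d k"])
        (simp add: scale_vars_simps const3_simps distrib_right sum.distrib)
  next
    case (gen k l h)
    obtain c where c: "coeff (scale_vars h) 0 = const3 c" using coeff_0_scale_vars by blast
    have "scale_vars (h * ?U ^ k * ?W ^ l) = monom (?U ^ k * ?W ^ l) (k + l) * scale_vars h"
      by (simp add: scale_vars_simps scale_vars_linear_form linear_monomial_power mult_monom mult_ac
          flip: mult_monom)
    then have "coeff (scale_vars (h * ?U ^ k * ?W ^ l)) m =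
        (if k + l = m then const3 c * ?U ^ k * ?W ^ l else 0)"
      using gen c by (auto simp: coeff_monom_mult)
    also have "\<dots> = (\<Sum>i\<le>m. const3 (if i = k \<and> k + l = m then c else 0) * ?U ^ i * ?W ^ (m - i))"
    proof (cases "k + l = m")
      case True
      then have "(\<Sum>i\<le>m. const3 (if i = k \<and> k + l = m then c else 0) * ?U ^ i * ?W ^ (m - i)) =
          (\<Sum>i\<le>m. if i = k then const3 c * ?U ^ k * ?W ^ (m - k) else 0)"
        by (intro sum.cong) (auto simp: const3_simps)
      also have "\<dots> = const3 c * ?U ^ k * ?W ^ l" using True by (subst sum.delta) auto
      finally show ?thesis using True by simp
    qed (simp add: const3_simps)
    finally show ?case by (rule exI[of _ "\<lambda>i. if i = k \<and> k + l = m then c else 0"])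
  qed
  from this[OF assms(2)] show ?thesis by (simp add: scale_vars_homogeneous[OF assms(1)])
qed

text \<open>The hypersurface of such a form consists of finitely many lines through the point where
  \<open>\<xi>\<close> and \<open>\<zeta>\<close> vanish. That none of them is the line \<open>\<xi> = 0\<close> means that the coefficient of
  \<open>\<zeta>\<^sup>m\<close> is nonzero.\<close>

lemma binary_form_zeros:
  fixes f :: "'k::field poly3"
  assumes "homogeneous f m" "f \<in> pair_power (linear_form \<xi>) (linear_form \<zeta>) m"
    and "restrict_line b f \<noteq> 0" "dot3 \<xi> b = 0" "dot3 \<zeta> b = 1"
  shows "\<exists>\<phi>. (\<forall>v. restrict_line v f = 0 \<longleftrightarrow> \<phi> (dot3 \<xi> v) (dot3 \<zeta> v) = (0 :: 'k)) \<and>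
    finite {\<alpha>. \<phi> 1 \<alpha> = 0} \<and> (\<forall>t. \<phi> 0 t = 0 \<longrightarrow> t = 0)"
proof -
  obtain c where f: "f = (\<Sum>k\<le>m. const3 (c k) * linear_form \<xi> ^ k * linear_form \<zeta> ^ (m - k))"
    using homogeneous_pair_power_binary_form[OF assms(1,2)] by blast
  define \<phi> where "\<phi> s t = (\<Sum>k\<le>m. c k * s ^ k * t ^ (m - k))" for s t
  have "restrict_line v f = monom (\<phi> (dot3 \<xi> v) (dot3 \<zeta> v)) m" for v
  proof -
    interpret h: type_hom "restrict_line v" by (rule type_hom_restrict_line)
    have "restrict_line v f = (\<Sum>k\<le>m. monom (c k * dot3 \<xi> v ^ k * dot3 \<zeta> v ^ (m - k)) m)"
      unfolding f h.sum
    proof (intro sum.cong refl)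
      fix k assume "k \<in> {..m}"
      then show "restrict_line v (const3 (c k) * linear_form \<xi> ^ k * linear_form \<zeta> ^ (m - k)) =
          monom (c k * dot3 \<xi> v ^ k * dot3 \<zeta> v ^ (m - k)) m"
        by (simp add: h.hom_simps restrict_line_const3 restrict_line_linear_form
            linear_monomial_power mult_monom smult_monom mult.assoc)
    qed
    then show ?thesis by (simp add: \<phi>_def monom_sum)
  qed
  then have zero: "restrict_line v f = 0 \<longleftrightarrow> \<phi> (dot3 \<xi> v) (dot3 \<zeta> v) = 0" for v by simp
  have \<phi>0: "\<phi> 0 t = c 0 * t ^ m" for t
    unfolding \<phi>_def by (subst sum.atMost_shift) simp
  have c0: "c 0 \<noteq> 0" using zero[of b] assms(3-5) by (simp add: \<phi>0)
  define p where "p = (\<Sum>k\<le>m. monom (c k) (m - k))"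
  have "coeff p m = (\<Sum>k\<le>m. if k = 0 then c 0 else 0)"
    unfolding p_def coeff_sum by (intro sum.cong) auto
  then have "p \<noteq> 0" using c0 by (auto simp: sum.delta)
  moreover have "\<phi> 1 \<alpha> = poly p \<alpha>" for \<alpha> by (simp add: \<phi>_def p_def poly_sum poly_monom)
  ultimately have "finite {\<alpha>. \<phi> 1 \<alpha> = 0}" using poly_roots_finite[of p] by simp
  moreover have "t = 0" if "\<phi> 0 t = 0" for t using that c0 by (cases "m = 0") (auto simp: \<phi>0)
  ultimately show ?thesis using zero by (intro exI[of _ \<phi>]) simp
qed

section \<open>Finite generation of the symbolic Rees ring\<close>

text \<open>The \<open>r\<close>-th symbolic power in coordinates where the two special points are \<open>(0:1:0)\<close> and \<open>(0:0:1)\<close> and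
  the others are the points \<open>(1:\<beta>:\<alpha>)\<close> of the grid.\<close>

definition grid_ideal :: "'k::field set \<Rightarrow> 'k set \<Rightarrow> nat \<Rightarrow> 'k poly3 set" where
  "grid_ideal S T r = {F. F \<in> pair_power var_x var_z r \<and> F \<in> pair_power var_x var_y r \<and>
     (\<forall>\<alpha>\<in>S. \<forall>\<beta>\<in>T. F \<in> pair_power (var_y - const3 \<beta> * var_x) (var_z - const3 \<alpha> * var_x) r)}"

lemma grid_ideal_0: "F \<in> grid_ideal S T 0"
  by (simp add: grid_ideal_def pair_power_0)

lemma grid_ideal_zero: "0 \<in> grid_ideal S T r"
  by (simp add: grid_ideal_def pair_power.zero)

lemma grid_ideal_add: "F \<in> grid_ideal S T r \<Longrightarrow> G \<in> grid_ideal S T r \<Longrightarrow> F + G \<in> grid_ideal S T r"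
  by (simp add: grid_ideal_def pair_power.add)

lemma grid_ideal_uminus: "F \<in> grid_ideal S T r \<Longrightarrow> - F \<in> grid_ideal S T r"
  by (simp add: grid_ideal_def pair_power_uminus)

lemma grid_ideal_mult:
  "F \<in> grid_ideal S T r \<Longrightarrow> G \<in> grid_ideal S T s \<Longrightarrow> F * G \<in> grid_ideal S T (r + s)"
  by (simp add: grid_ideal_def pair_power_mult)

lemma grid_ideal_monomial:
  assumes "finite S" "finite T" "(h, i, j, a, b, r) \<in> admissible_exponents (card S) (card T)"
  shows "var_x ^ h * var_y ^ i * var_z ^ j * lines_z S ^ a * lines_y T ^ b \<in> grid_ideal S T r"
proof -
  let ?f = "lines_z S" and ?g = "lines_y T"
  have r: "r \<le> a + b" "r \<le> h + (j + a * card S)" "r \<le> h + (i + b * card T)"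
    using assms(3) by (auto simp: admissible_exponents_def mult.commute)
  have gen: "u ^ k \<in> pair_power u v k" "v ^ k \<in> pair_power u v k" for u v :: "'a poly3" and k
    using pair_power.gen[of k k 0 1 u v] pair_power.gen[of k 0 k 1 u v] by simp_all
  have "var_x ^ h * (var_z ^ j * ?f ^ a) \<in> pair_power var_x var_z (h + (j + a * card S))"
    by (intro pair_power_mult gen pair_power_power lines_z_order assms)
  from pair_power_scale[OF pair_power_antimono[OF this r(2)], of "var_y ^ i * ?g ^ b"]
  have 1: "var_x ^ h * var_y ^ i * var_z ^ j * ?f ^ a * ?g ^ b \<in> pair_power var_x var_z r"
    by (simp add: mult_ac)
  have "var_x ^ h * (var_y ^ i * ?g ^ b) \<in> pair_power var_x var_y (h + (i + b * card T))"
    by (intro pair_power_mult gen pair_power_power lines_y_order assms)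
  from pair_power_scale[OF pair_power_antimono[OF this r(3)], of "var_z ^ j * ?f ^ a"]
  have 2: "var_x ^ h * var_y ^ i * var_z ^ j * ?f ^ a * ?g ^ b \<in> pair_power var_x var_y r"
    by (simp add: mult_ac)
  have 3: "var_x ^ h * var_y ^ i * var_z ^ j * ?f ^ a * ?g ^ b \<in> pair_power u v r"
    if "\<alpha> \<in> S" "\<beta> \<in> T" "u = var_y - const3 \<beta> * var_x" "v = var_z - const3 \<alpha> * var_x" for \<alpha> \<beta> u v
  proof -
    have f: "?f = lines_z (S - {\<alpha>}) * v" and g: "?g = lines_y (T - {\<beta>}) * u"
      using assms(1,2) that by (simp_all add: lines_y_def lines_z_def prod.remove mult.commute)
    have "?f \<in> pair_power u v 1" "?g \<in> pair_power u v 1"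
      unfolding f g by (intro pair_power_scale pair_power_generators)+
    then have "?f ^ a * ?g ^ b \<in> pair_power u v (a * 1 + b * 1)"
      by (intro pair_power_mult pair_power_power)
    then have "?f ^ a * ?g ^ b \<in> pair_power u v r"
      by (rule pair_power_antimono) (use r(1) in simp)
    from pair_power_scale[OF this, of "var_x ^ h * var_y ^ i * var_z ^ j"] show ?thesis
      by (simp only: mult.assoc)
  qed
  from 1 2 3 show ?thesis unfolding grid_ideal_def by blast
qed

lemma generate_ring_type:
  fixes G :: "'a::comm_ring_1 set"
  defines "gen \<equiv> generate_ring ring_of_type_algebra G"
  shows "1 \<in> gen" "0 \<in> gen" "g \<in> G \<Longrightarrow> g \<in> gen"
    "p \<in> gen \<Longrightarrow> q \<in> gen \<Longrightarrow> p + q \<in> gen" "p \<in> gen \<Longrightarrow> q \<in> gen \<Longrightarrow> p * q \<in> gen"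
proof -
  show 1: "1 \<in> gen" and "g \<in> G \<Longrightarrow> g \<in> gen"
    and add: "\<And>p q. p \<in> gen \<Longrightarrow> q \<in> gen \<Longrightarrow> p + q \<in> gen" and "p \<in> gen \<Longrightarrow> q \<in> gen \<Longrightarrow> p * q \<in> gen"
    using generate_ring.one[of "ring_of_type_algebra :: 'a ring" G]
      generate_ring.incl[of g G "ring_of_type_algebra :: 'a ring"]
      generate_ring.eng_add[of _ "ring_of_type_algebra :: 'a ring" G]
      generate_ring.eng_mult[of p "ring_of_type_algebra :: 'a ring" G q]
    by (simp_all add: gen_def ring_of_type_algebra_def)
  have "- 1 \<in> gen"
    using generate_ring.a_inv[of "1 :: 'a" ring_of_type_algebra G] 1 by (simp add: gen_def a_inv_type)
  with add[OF 1] show "0 \<in> gen" by fastforce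
qed

text \<open>The ring in question is spanned over \<open>K\<close> by the monomials with admissible exponents, and these
  form a finitely generated monoid.\<close>

lemma finitely_generated_grid:
  fixes \<sigma> :: "'k::field poly3 \<Rightarrow> 'k poly3"
  assumes \<sigma>: "type_hom \<sigma>" "\<And>c. \<sigma> (const3 c) = const3 c" "surj \<sigma>"
    and fin: "finite S" "finite T"
  shows "finitely_generated_algebra {F. \<forall>r. coeff F r \<in> \<sigma> ` grid_ideal S T r}"
    (is "finitely_generated_algebra ?B")
proof -
  interpret \<sigma>: type_hom \<sigma> by fact
  let ?m = "card S" and ?n = "card T"
  define \<mu> where "\<mu> = (\<lambda>(h, i, j, a, b, r :: nat).
    monom (\<sigma> (var_x ^ h * var_y ^ i * var_z ^ j * lines_z S ^ a * lines_y T ^ b)) r)"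
  obtain D where D: "finite D" "D \<subseteq> admissible_exponents ?m ?n"
    "\<And>P w. P (0, 0, 0, 0, 0, 0) \<Longrightarrow> (\<And>u. u \<in> D \<Longrightarrow> P u) \<Longrightarrow>
      (\<And>h i j a b r h' i' j' a' b' r'. P (h, i, j, a, b, r) \<Longrightarrow> P (h', i', j', a', b', r') \<Longrightarrow>
        P (h + h', i + i', j + j', a + a', b + b', r + r')) \<Longrightarrow>
      w \<in> admissible_exponents ?m ?n \<Longrightarrow> P w"
    using admissible_exponents_finite_generators[of ?m ?n] by metis
  define G where "G = range (\<lambda>s. [:s:]) \<union> \<mu> ` D"
  let ?gen = "generate_ring ring_of_type_algebra G"
  note gen = generate_ring_type[where G = G]
  have \<mu>: "\<mu> w \<in> ?gen" if "w \<in> admissible_exponents ?m ?n" for w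
  proof (rule D(3)[OF _ _ _ that])
    show "\<mu> (0, 0, 0, 0, 0, 0) \<in> ?gen" using gen(1) by (simp add: \<mu>_def \<sigma>.one)
    show "\<mu> u \<in> ?gen" if "u \<in> D" for u using that by (intro gen(3)) (simp add: G_def)
    fix h i j a b r h' i' j' a' b' r'
    assume "\<mu> (h, i, j, a, b, r) \<in> ?gen" "\<mu> (h', i', j', a', b', r') \<in> ?gen"
    then have "\<mu> (h, i, j, a, b, r) * \<mu> (h', i', j', a', b', r') \<in> ?gen" by (rule gen(5))
    then show "\<mu> (h + h', i + i', j + j', a + a', b + b', r + r') \<in> ?gen"
      by (simp add: \<mu>_def mult_monom \<sigma>.hom_simps power_add mult_ac add.commute[of r r'])
  qed
  have homogeneous_part: "monom (\<sigma> F) r \<in> ?gen" if "F \<in> grid_ideal S T r" for F r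
  proof -
    have "F \<in> monomial_span (lines_z S) (lines_y T) ?m ?n r r r"
      using that fin by (intro in_monomial_span) (auto simp: grid_ideal_def)
    then show ?thesis
    proof (induction F rule: monomial_span.induct)
      case zero
      then show ?case using gen(2) by (simp add: \<sigma>.zero)
    next
      case (add F F')
      then show ?case using gen(4) by (simp add: \<sigma>.add flip: add_monom)
    next
      case (monomial a b h j i c)
      then have "(h, i, j, a, b, r) \<in> admissible_exponents ?m ?n"
        by (simp add: admissible_exponents_def)
      then have "[:const3 c:] * \<mu> (h, i, j, a, b, r) \<in> ?gen"
        by (intro gen(5) \<mu> gen(3)) (simp_all add: G_def)
      then show ?case by (simp add: \<mu>_def \<sigma>.hom_simps \<sigma>(2) smult_monom)
    qed
  qed
  have "?B = ?gen"
  proof (intro subset_antisym subsetI)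
    fix F assume "F \<in> ?B"
    then have "coeff F r \<in> \<sigma> ` grid_ideal S T r" for r by simp
    then have "monom (coeff F r) r \<in> ?gen" for r
      using homogeneous_part by (metis imageE)
    then have "(\<Sum>r\<in>I. monom (coeff F r) r) \<in> ?gen" for I
      by (induction I rule: infinite_finite_induct) (simp_all add: gen)
    from this[of "{..degree F}"] show "F \<in> ?gen" by (simp add: poly_as_sum_of_monoms)
  next
    fix F assume "F \<in> ?gen"
    then show "F \<in> ?B"
    proof (induction F rule: generate_ring.induct)
      case one
      then show ?case
        using grid_ideal_0[of 1 S T] grid_ideal_zero[of S T]
        by (auto simp: ring_of_type_algebra_def coeff_1 image_iff \<sigma>.one \<sigma>.zero
            intro: bexI[of _ 1] bexI[of _ 0])
    next
      case (incl F)
      then consider s where "F = [:s:]" | w where "w \<in> D" "F = \<mu> w" by (auto simp: G_def)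
      then show ?case
      proof cases
        case (1 s)
        obtain s' where s': "s = \<sigma> s'" using \<sigma>(3) by (metis surjD)
        have "coeff F r \<in> \<sigma> ` grid_ideal S T r" for r
          unfolding 1 s' using grid_ideal_0[of s' S T] grid_ideal_zero[of S T r]
          by (cases r) (auto simp: image_iff \<sigma>.zero intro: bexI[of _ 0])
        then show ?thesis by simp
      next
        case (2 w)
        obtain h i j a b r where w: "w = (h, i, j, a, b, r)" by (cases w)
        have "coeff F s \<in> \<sigma> ` grid_ideal S T s" for s
          using grid_ideal_monomial[OF fin, of h i j a b r] D(2) 2 w grid_ideal_zero[of S T s]
          by (auto simp: \<mu>_def image_iff \<sigma>.zero intro: bexI[of _ 0])
        then show ?thesis by simp
      qed
    next
      case (a_inv F)
      have "coeff (- F) r \<in> \<sigma> ` grid_ideal S T r" for r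
      proof -
        obtain F' where "coeff F r = \<sigma> F'" "F' \<in> grid_ideal S T r" using a_inv by auto
        then show ?thesis by (auto simp: image_iff intro!: bexI[of _ "- F'"] grid_ideal_uminus simp: \<sigma>.uminus)
      qed
      then show ?case by (simp add: a_inv_type)
    next
      case (eng_add F F')
      have "coeff (F + F') r \<in> \<sigma> ` grid_ideal S T r" for r
      proof -
        have "coeff F r \<in> \<sigma> ` grid_ideal S T r" "coeff F' r \<in> \<sigma> ` grid_ideal S T r"
          using eng_add.IH by simp_all
        then obtain E E' where "coeff F r = \<sigma> E" "E \<in> grid_ideal S T r"
          "coeff F' r = \<sigma> E'" "E' \<in> grid_ideal S T r" by (elim imageE)
        then show ?thesis by (auto simp: image_iff intro!: bexI[of _ "E + E'"] grid_ideal_add simp: \<sigma>.add)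
      qed
      then show ?case by (simp add: ring_of_type_algebra_def)
    next
      case (eng_mult F F')
      have "coeff (F * F') r \<in> \<sigma> ` grid_ideal S T r" for r
      proof -
        have "\<forall>i. \<exists>E. coeff F i = \<sigma> E \<and> E \<in> grid_ideal S T i"
          "\<forall>i. \<exists>E. coeff F' i = \<sigma> E \<and> E \<in> grid_ideal S T i" using eng_mult.IH by blast+
        then obtain E E' where E: "\<And>i. coeff F i = \<sigma> (E i)" "\<And>i. E i \<in> grid_ideal S T i"
          "\<And>i. coeff F' i = \<sigma> (E' i)" "\<And>i. E' i \<in> grid_ideal S T i" by metis
        have sum: "(\<Sum>i\<in>I. E i * E' (r - i)) \<in> grid_ideal S T r" if "I \<subseteq> {..r}" for I
          using that
        proof (induction I rule: infinite_finite_induct)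
          case (insert i I)
          have "E i * E' (r - i) \<in> grid_ideal S T (i + (r - i))" by (intro grid_ideal_mult E)
          then show ?case using insert by (simp add: grid_ideal_add)
        qed (simp_all add: grid_ideal_zero)
        have "coeff (F * F') r = \<sigma> (\<Sum>i\<le>r. E i * E' (r - i))"
          by (simp add: coeff_mult E \<sigma>.sum \<sigma>.mult)
        then show ?thesis using sum[of "{..r}"] by simp
      qed
      then show ?case by (simp add: ring_of_type_algebra_def)
    qed
  qed
  then show ?thesis
    unfolding finitely_generated_algebra_def G_def using D(1) by blast
qed

theorem theorem1p5:
  fixes f g :: "'k::alg_closed_field poly3"
    and m n :: nat
    and A B :: "'k proj_plane"
    and H :: "'k proj_plane set"
  assumes "homogeneous f m" and "homogeneous g n"
    and "reduced_ring (ring_of_type_algebra Quot ideal_gen {f, g})"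
    and "krull_dim (ring_of_type_algebra Quot ideal_gen {f, g}) = 1"
    and "A \<noteq> B"
    and "f \<in> ideal_pow (point_ideal A) m" and "g \<in> ideal_pow (point_ideal B) n"
    and "f \<notin> point_ideal B" and "g \<notin> point_ideal A"
    and "H = {A, B} \<union> {P. ideal_gen {f, g} \<subseteq> point_ideal P}"
  shows "finitely_generated_algebra (symbolic_rees (points_ideal H))"
proof -
  obtain a where a: "a \<noteq> (0, 0, 0)" "A = abs_proj_plane a" by (rule proj_plane_cases)
  obtain b where b: "b \<noteq> (0, 0, 0)" "B = abs_proj_plane b" by (rule proj_plane_cases)
  have "cross3 a b \<noteq> (0, 0, 0)"
    using cross3_nonzero[OF a(1) b(1)] abs_proj_plane_eq assms(5) a(2) b(2) by blast
  then obtain \<xi> \<eta> \<zeta> where dots: "dot3 \<xi> a = 0" "dot3 \<xi> b = 0" "dot3 \<eta> a = 1" "dot3 \<eta> b = 0"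
      "dot3 \<zeta> a = 0" "dot3 \<zeta> b = 1"
    and bij: "bij (endo3 (linear_form \<xi>) (linear_form \<eta>) (linear_form \<zeta>))"
    and ex: "\<And>\<beta> \<alpha>. \<exists>w. dot3 \<xi> w = 1 \<and> dot3 \<eta> w = \<beta> \<and> dot3 \<zeta> w = \<alpha>"
    and nondeg: "\<And>w. dot3 \<xi> w = 0 \<Longrightarrow> dot3 \<eta> w = 0 \<Longrightarrow> dot3 \<zeta> w = 0 \<Longrightarrow> w = (0, 0, 0)"
    by (rule exists_dual_basis) blast
  define \<sigma> where "\<sigma> = endo3 (linear_form \<xi>) (linear_form \<eta>) (linear_form \<zeta>)"
  have \<sigma>: "type_hom \<sigma>" "bij \<sigma>" using bij by (simp_all add: \<sigma>_def type_hom_endo3)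
  have \<sigma>_line: "restrict_line v (\<sigma> F) = restrict_line (dot3 \<xi> v, dot3 \<eta> v, dot3 \<zeta> v) F" for v F
    unfolding \<sigma>_def by (rule restrict_line_endo3)
  have IA: "point_ideal A = pair_power (\<sigma> var_x) (\<sigma> var_z) 1"
    unfolding a(2) point_ideal_abs[OF a(1)]
    by (rule point_kernel_transport[OF \<sigma> \<sigma>_line]) (simp add: dots restrict_line_kernel_standard)
  have IB: "point_ideal B = pair_power (\<sigma> var_x) (\<sigma> var_y) 1"
    unfolding b(2) point_ideal_abs[OF b(1)]
    by (rule point_kernel_transport[OF \<sigma> \<sigma>_line]) (simp add: dots restrict_line_kernel_standard)
  have IP: "point_ideal (abs_proj_plane w) =
      pair_power (\<sigma> (var_y - const3 (dot3 \<eta> w) * var_x)) (\<sigma> (var_z - const3 (dot3 \<zeta> w) * var_x)) 1"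
    if "dot3 \<xi> w = 1" for w
  proof -
    have "w \<noteq> (0, 0, 0)" using that by (auto simp: dot3_def split: prod.splits)
    then show ?thesis
      unfolding point_ideal_abs[OF \<open>w \<noteq> (0, 0, 0)\<close>]
      by (intro point_kernel_transport[OF \<sigma> \<sigma>_line])
        (simp add: that restrict_line_kernel_standard(3))
  qed
  have \<sigma>_vars: "\<sigma> var_x = linear_form \<xi>" "\<sigma> var_y = linear_form \<eta>" "\<sigma> var_z = linear_form \<zeta>"
    by (simp_all add: \<sigma>_def endo3_simps)
  have fA: "f \<in> pair_power (linear_form \<xi>) (linear_form \<zeta>) m"
    and gB: "g \<in> pair_power (linear_form \<xi>) (linear_form \<eta>) n"
    using assms(6,7) unfolding IA IB ideal_pow_pair_power \<sigma>_vars .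
  have fB: "restrict_line b f \<noteq> 0" and gA: "restrict_line a g \<noteq> 0"
    using assms(8,9) a b by (simp_all add: point_ideal_abs)
  obtain \<phi> :: "'k \<Rightarrow> 'k \<Rightarrow> 'k"
    where \<phi>: "\<forall>v. restrict_line v f = 0 \<longleftrightarrow> \<phi> (dot3 \<xi> v) (dot3 \<zeta> v) = 0"
      "finite {\<alpha>. \<phi> 1 \<alpha> = 0}" "\<forall>t. \<phi> 0 t = 0 \<longrightarrow> t = 0"
    using binary_form_zeros[OF assms(1) fA fB dots(2,6)] by (elim exE conjE)
  obtain \<psi> :: "'k \<Rightarrow> 'k \<Rightarrow> 'k"
    where \<psi>: "\<forall>v. restrict_line v g = 0 \<longleftrightarrow> \<psi> (dot3 \<xi> v) (dot3 \<eta> v) = 0"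
      "finite {\<beta>. \<psi> 1 \<beta> = 0}" "\<forall>t. \<psi> 0 t = 0 \<longrightarrow> t = 0"
    using binary_form_zeros[OF assms(2) gB gA dots(1,3)] by (elim exE conjE)
  \<comment> \<open>The line \<open>\<xi> = 0\<close> through \<open>A\<close> and \<open>B\<close> contains no common zero, so all common zeros have a
    representative with \<open>\<xi> = 1\<close>, and there the two equations separate.\<close>
  define S where "S = {\<alpha>. \<phi> 1 \<alpha> = 0}"
  define T where "T = {\<beta>. \<psi> 1 \<beta> = 0}"
  have fin: "finite S" "finite T" using \<phi>(2) \<psi>(2) by (simp_all add: S_def T_def)
  have common_zeros: "{P. ideal_gen {f, g} \<subseteq> point_ideal P} =
      {abs_proj_plane w | w. dot3 \<xi> w = 1 \<and> dot3 \<eta> w \<in> T \<and> dot3 \<zeta> w \<in> S}" (is "?Z = ?W")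
  proof -
    have mem: "ideal_gen {f, g} \<subseteq> point_ideal (abs_proj_plane v) \<longleftrightarrow>
        restrict_line v f = 0 \<and> restrict_line v g = 0" if "v \<noteq> (0, 0, 0)" for v
      using ideal_gen_superset[of "{f, g}"] ideal_gen_least[of "point_ideal (abs_proj_plane v)" "{f, g}"]
        primeideal_point_ideal[of "abs_proj_plane v"] that
      by (auto simp: point_ideal_abs primeideal_type_iff)
    show ?thesis
    proof (intro subset_antisym subsetI)
      fix P assume "P \<in> ?Z"
      obtain v where v: "v \<noteq> (0, 0, 0)" "P = abs_proj_plane v" by (rule proj_plane_cases)
      have zero: "restrict_line v f = 0" "restrict_line v g = 0"
        using \<open>P \<in> ?Z\<close> mem[OF v(1)] v(2) by auto
      have u: "dot3 \<xi> v \<noteq> 0"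
      proof
        assume "dot3 \<xi> v = 0"
        then have "\<phi> 0 (dot3 \<zeta> v) = 0" "\<psi> 0 (dot3 \<eta> v) = 0"
          using \<phi>(1)[rule_format, of v] \<psi>(1)[rule_format, of v] zero by simp_all
        then have "dot3 \<zeta> v = 0" "dot3 \<eta> v = 0" using \<phi>(3) \<psi>(3) by blast+
        then show False using nondeg \<open>dot3 \<xi> v = 0\<close> v(1) by blast
      qed
      obtain v1 v2 v3 where v_eq: "v = (v1, v2, v3)" by (cases v)
      define w where "w = (v1 / dot3 \<xi> v, v2 / dot3 \<xi> v, v3 / dot3 \<xi> v)"
      have rel: "proj_rel v w"
        using v(1) u by (auto simp: proj_rel_def v_eq w_def intro!: exI[of _ "1 / dot3 \<xi> v"])
      then have P: "P = abs_proj_plane w" using v(2) abs_proj_plane_eq by blast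
      have w: "dot3 l w = dot3 l v / dot3 \<xi> v" for l
        by (cases l) (simp add: dot3_def w_def v_eq add_divide_distrib)
      then have "dot3 \<xi> w = 1" using u by simp
      moreover from this have "w \<noteq> (0, 0, 0)" by (auto simp: dot3_def split: prod.splits)
      then have "restrict_line w f = 0" "restrict_line w g = 0"
        using \<open>P \<in> ?Z\<close> mem P by auto
      ultimately have "dot3 \<eta> w \<in> T" "dot3 \<zeta> w \<in> S"
        using \<phi>(1)[rule_format, of w] \<psi>(1)[rule_format, of w] by (simp_all add: S_def T_def)
      then show "P \<in> ?W" using P \<open>dot3 \<xi> w = 1\<close> by blast
    next
      fix P assume "P \<in> ?W"
      then obtain w where w: "P = abs_proj_plane w" "dot3 \<xi> w = 1" "dot3 \<eta> w \<in> T" "dot3 \<zeta> w \<in> S"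
        by blast
      have "w \<noteq> (0, 0, 0)" using w(2) by (auto simp: dot3_def split: prod.splits)
      then show "P \<in> ?Z" using mem \<phi>(1)[rule_format, of w] \<psi>(1)[rule_format, of w] w by (simp add: S_def T_def)
    qed
  qed
  \<comment> \<open>A point is determined by its ideal, and the ideal of a point with \<open>\<xi> = 1\<close> by the other two
    coordinates.\<close>
  have "finite H"
  proof (rule finite_imageD)
    have "point_ideal ` H \<subseteq> {point_ideal A, point_ideal B} \<union>
      (\<lambda>(\<beta>, \<alpha>). pair_power (\<sigma> (var_y - const3 \<beta> * var_x)) (\<sigma> (var_z - const3 \<alpha> * var_x)) 1) ` (T \<times> S)"
      unfolding assms(10) common_zeros using IP by fastforce
    then show "finite (point_ideal ` H)" by (rule finite_subset) (use fin in simp)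
    show "inj_on point_ideal H" by (rule inj_onI) (simp add: point_ideal_subset_imp_eq)
  qed
  have "symbolic_power (points_ideal H) r = \<sigma> ` grid_ideal S T r" for r
  proof -
    have "\<sigma> F \<in> (\<Inter>P\<in>H. ideal_pow (point_ideal P) r) \<longleftrightarrow> F \<in> grid_ideal S T r" for F
    proof -
      have "(\<forall>P\<in>?W. \<sigma> F \<in> ideal_pow (point_ideal P) r) \<longleftrightarrow> (\<forall>\<alpha>\<in>S. \<forall>\<beta>\<in>T.
          F \<in> pair_power (var_y - const3 \<beta> * var_x) (var_z - const3 \<alpha> * var_x) r)"
        (is "?L \<longleftrightarrow> ?R")
      proof -
        have *: "\<sigma> F \<in> ideal_pow (point_ideal (abs_proj_plane w)) r \<longleftrightarrow>
            F \<in> pair_power (var_y - const3 (dot3 \<eta> w) * var_x) (var_z - const3 (dot3 \<zeta> w) * var_x) r"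
          if "dot3 \<xi> w = 1" for w
          unfolding IP[OF that] ideal_pow_pair_power pair_power_bij_iff[OF \<sigma>] ..
        have "?R" if ?L
        proof (intro ballI)
          fix \<alpha> \<beta> assume "\<alpha> \<in> S" "\<beta> \<in> T"
          moreover obtain w where w: "dot3 \<xi> w = 1" "dot3 \<eta> w = \<beta>" "dot3 \<zeta> w = \<alpha>" using ex by blast
          ultimately have "abs_proj_plane w \<in> ?W" by blast
          then show "F \<in> pair_power (var_y - const3 \<beta> * var_x) (var_z - const3 \<alpha> * var_x) r"
            using \<open>?L\<close> *[OF w(1)] w(2,3) by blast
        qed
        moreover have "?L" if ?R using that * by blast
        ultimately show ?thesis by blast
      qed
      moreover have "\<sigma> F \<in> ideal_pow (point_ideal A) r \<longleftrightarrow> F \<in> pair_power var_x var_z r"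
        unfolding IA ideal_pow_pair_power pair_power_bij_iff[OF \<sigma>] ..
      moreover have "\<sigma> F \<in> ideal_pow (point_ideal B) r \<longleftrightarrow> F \<in> pair_power var_x var_y r"
        unfolding IB ideal_pow_pair_power pair_power_bij_iff[OF \<sigma>] ..
      ultimately show ?thesis unfolding assms(10) common_zeros grid_ideal_def by auto
    qed
    note iff = this
    show ?thesis
      unfolding symbolic_power_points_ideal[OF \<open>finite H\<close>]
    proof (rule Set.set_eqI)
      fix F
      obtain F' where F: "F = \<sigma> F'" using \<sigma>(2) by (meson bij_pointE)
      show "F \<in> (\<Inter>P\<in>H. ideal_pow (point_ideal P) r) \<longleftrightarrow> F \<in> \<sigma> ` grid_ideal S T r"
        unfolding F iff inj_image_mem_iff[OF bij_is_inj[OF \<sigma>(2)]] ..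
    qed
  qed
  then show ?thesis
    unfolding symbolic_rees_def
    using finitely_generated_grid[OF \<sigma>(1) _ bij_is_surj[OF \<sigma>(2)] fin]
    by (simp add: \<sigma>_def endo3_simps)
qed

end
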